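(* There exist a separable complex Hilbert space $H$ and a bounded linear operator $T$ on $H$ such that $T$ is uniformly Kreiss bounded but $T$ is not strongly Cesàro bounded.
   Context: Let $X$ be a complex Banach space with dual space $X^*$, and let $T$ be a bounded linear operator on $X$. The operator $T$ is called uniformly Kreiss bounded if there exists $C>0$ such that $$\left\|\sum_{k=0}^{n}\lambda^{-k-1}T^k\right\|\leq \frac{C}{|\lambda|-1}\qquad\text{for all integers } n\geq 0 \text{ and all } \lambda\in\mathbb{C} \text{ with } |\lambda|>1.$$ The operator $T$ is called strongly Cesàro bounded if there exists $C>0$ such that $$\frac1N\sum_{k=0}^{N-1}\bigl|\langle x^*,T^kx\rangle\bigr|\leq C\,\|x\|\,\|x^*\|\qquad\text{for all } x\in X,\ x^*\in X^*,\ N\geq 1,$$ where $\langle x^*,y\rangle$ denotes the value of the functional $x^*$ at $y\in X$. *)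

theory Defs
  imports "HOL-Analysis.Analysis" "HOL-Algebra.Module"
begin

text \<open>
  The existence of a Hilbert space is stated by quantifying over structures, so complex normed
  spaces are modules in the sense of HOL-Algebra, with an explicit carrier and a norm.  The fields
  \<open>mult\<close> and \<open>one\<close> that the record type of modules inherits from rings carry no meaning for
  vectors, and nothing is required of them.  Every separable complex Hilbert space has an
  isometric copy whose elements are of type \<open>nat \<Rightarrow> complex\<close> (coefficient sequences).
\<close>

record 'a cnormed_space = "(complex, 'a) module" +
  vnorm :: "'a \<Rightarrow> real"

text \<open>The complex numbers, as the scalar field and at the same time as a normed space over it.\<close>

definition complex_line :: "complex cnormed_space" where
  "complex_line =
    \<lparr>carrier = UNIV, monoid.mult = (*), one = 1, ring.zero = 0, add = (+), smult = (*),
     vnorm = cmod\<rparr>"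

lemma complex_line_simps [simp]:
  "carrier complex_line = UNIV"
  "x \<otimes>\<^bsub>complex_line\<^esub> y = x * y"
  "\<one>\<^bsub>complex_line\<^esub> = 1"
  "\<zero>\<^bsub>complex_line\<^esub> = 0"
  "x \<oplus>\<^bsub>complex_line\<^esub> y = x + y"
  "x \<odot>\<^bsub>complex_line\<^esub> y = x * y"
  "vnorm complex_line x = cmod x"
  by (simp_all add: complex_line_def)

lemma cring_complex_line: "cring complex_line"
proof (rule cringI)
  show "abelian_group complex_line"
  proof (rule abelian_groupI)
    show "\<exists>y\<in>carrier complex_line. y \<oplus>\<^bsub>complex_line\<^esub> x = \<zero>\<^bsub>complex_line\<^esub>" for x
      by (simp add: exI[of _ "- x"])
  qed (simp_all add: algebra_simps)
  show "comm_monoid complex_line"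
    by (rule comm_monoidI) (simp_all add: algebra_simps)
qed (simp add: algebra_simps)

text \<open>Metric spaces demand non-negative distances also off the carrier, hence the case distinction.\<close>

definition norm_dist :: "('a, 'b) cnormed_space_scheme \<Rightarrow> 'a \<Rightarrow> 'a \<Rightarrow> real" where
  "norm_dist X x y =
    (if x \<in> carrier X \<and> y \<in> carrier X then vnorm X (x \<ominus>\<^bsub>X\<^esub> y) else 0)"

locale complex_normed_space = module complex_line X
  for X :: "('a, 'b) cnormed_space_scheme" (structure) +
  assumes vnorm_nonneg: "x \<in> carrier X \<Longrightarrow> 0 \<le> vnorm X x"
    and vnorm_eq_0_iff: "x \<in> carrier X \<Longrightarrow> vnorm X x = 0 \<longleftrightarrow> x = \<zero>\<^bsub>X\<^esub>"
    and vnorm_triangle: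
      "x \<in> carrier X \<Longrightarrow> y \<in> carrier X \<Longrightarrow> vnorm X (x \<oplus>\<^bsub>X\<^esub> y) \<le> vnorm X x + vnorm X y"
    and vnorm_smult: "x \<in> carrier X \<Longrightarrow> vnorm X (a \<odot>\<^bsub>X\<^esub> x) = cmod a * vnorm X x"
begin

lemma smult_minus_one: "x \<in> carrier X \<Longrightarrow> (- 1) \<odot>\<^bsub>X\<^esub> x = \<ominus>\<^bsub>X\<^esub> x"
proof -
  assume x: "x \<in> carrier X"
  have "(- 1) \<odot>\<^bsub>X\<^esub> x \<oplus>\<^bsub>X\<^esub> x = \<zero>\<^bsub>X\<^esub>"
    using smult_l_distr[of "- 1" 1 x] smult_one[OF x] smult_l_null[OF x] x by simp
  then show ?thesis
    using M.minus_equality x smult_closed[of "- 1" x] by simp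
qed

lemma vnorm_minus: "x \<in> carrier X \<Longrightarrow> vnorm X (\<ominus>\<^bsub>X\<^esub> x) = vnorm X x"
  using vnorm_smult[of x "- 1"] smult_minus_one by simp

sublocale norm_metric: Metric_space "carrier X" "norm_dist X"
proof
  show "0 \<le> norm_dist X x y" for x y
    by (simp add: norm_dist_def vnorm_nonneg)
  show "norm_dist X x y = norm_dist X y x" for x y
  proof (cases "x \<in> carrier X \<and> y \<in> carrier X")
    case True
    then have "\<ominus>\<^bsub>X\<^esub> (y \<ominus>\<^bsub>X\<^esub> x) = x \<ominus>\<^bsub>X\<^esub> y"
      by (simp add: a_minus_def M.minus_add M.a_comm)
    with True show ?thesis
      using vnorm_minus[of "y \<ominus>\<^bsub>X\<^esub> x"] by (simp add: norm_dist_def)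
  qed (auto simp: norm_dist_def)
  show "norm_dist X x y = 0 \<longleftrightarrow> x = y" if "x \<in> carrier X" "y \<in> carrier X" for x y
  proof
    assume "norm_dist X x y = 0"
    then have "x \<oplus>\<^bsub>X\<^esub> \<ominus>\<^bsub>X\<^esub> y = \<zero>\<^bsub>X\<^esub>"
      using that by (simp add: norm_dist_def vnorm_eq_0_iff a_minus_def)
    then show "x = y"
      using that M.minus_equality[of x "\<ominus>\<^bsub>X\<^esub> y"] by simp
  next
    assume "x = y"
    then show "norm_dist X x y = 0"
      using that by (simp add: norm_dist_def vnorm_eq_0_iff a_minus_def M.r_neg)
  qed
  show "norm_dist X x z \<le> norm_dist X x y + norm_dist X y z"
    if xyz: "x \<in> carrier X" "y \<in> carrier X" "z \<in> carrier X" for x y z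
  proof -
    have "(x \<ominus>\<^bsub>X\<^esub> y) \<oplus>\<^bsub>X\<^esub> (y \<ominus>\<^bsub>X\<^esub> z) = x \<ominus>\<^bsub>X\<^esub> z"
      using xyz by (simp add: a_minus_def M.a_assoc M.r_neg1)
    then show ?thesis
      using vnorm_triangle[of "x \<ominus>\<^bsub>X\<^esub> y" "y \<ominus>\<^bsub>X\<^esub> z"] xyz by (simp add: norm_dist_def)
  qed
qed

end

locale complex_banach_space = complex_normed_space X
  for X :: "('a, 'b) cnormed_space_scheme" (structure) +
  assumes norm_complete: "norm_metric.mcomplete"

definition separable_normed_space :: "('a, 'b) cnormed_space_scheme \<Rightarrow> bool" where
  "separable_normed_space X \<longleftrightarrow>
    separable_space (Metric_space.mtopology (carrier X) (norm_dist X))"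

record 'a cinner_space = "'a cnormed_space" +
  cinner :: "'a \<Rightarrow> 'a \<Rightarrow> complex"

locale complex_hilbert_space = complex_banach_space H
  for H :: "('a, 'b) cinner_space_scheme" (structure) +
  assumes cinner_add_left:
      "x \<in> carrier H \<Longrightarrow> y \<in> carrier H \<Longrightarrow> z \<in> carrier H \<Longrightarrow>
        cinner H (x \<oplus>\<^bsub>H\<^esub> y) z = cinner H x z + cinner H y z"
    and cinner_smult_left:
      "x \<in> carrier H \<Longrightarrow> y \<in> carrier H \<Longrightarrow> cinner H (a \<odot>\<^bsub>H\<^esub> x) y = a * cinner H x y"
    and cinner_commute:
      "x \<in> carrier H \<Longrightarrow> y \<in> carrier H \<Longrightarrow> cinner H x y = cnj (cinner H y x)"
    and vnorm_eq_sqrt_cinner: "x \<in> carrier H \<Longrightarrow> vnorm H x = sqrt (Re (cinner H x x))"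

text \<open>
  Positivity of the inner product is implied: by symmetry \<open>cinner H x x\<close> is real, and its square
  root is the norm of \<open>x\<close>.
\<close>

lemma (in complex_hilbert_space) cinner_self:
  "x \<in> carrier H \<Longrightarrow> cinner H x x = complex_of_real ((vnorm H x)\<^sup>2)"
proof -
  assume x: "x \<in> carrier H"
  have "0 \<le> Re (cinner H x x)"
    using vnorm_nonneg[OF x] vnorm_eq_sqrt_cinner[OF x] by simp
  moreover have "Im (cinner H x x) = 0"
    using arg_cong[OF cinner_commute[OF x x], of Im] by simp
  ultimately show ?thesis
    by (simp add: complex_eq_iff vnorm_eq_sqrt_cinner[OF x])
qed

definition linear_operator ::
    "('a, 'c) cnormed_space_scheme \<Rightarrow> ('b, 'd) cnormed_space_scheme \<Rightarrow> ('a \<Rightarrow> 'b) \<Rightarrow> bool" where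
  "linear_operator X Y S \<longleftrightarrow>
    S \<in> carrier X \<rightarrow> carrier Y \<and>
    (\<forall>x\<in>carrier X. \<forall>y\<in>carrier X. S (x \<oplus>\<^bsub>X\<^esub> y) = S x \<oplus>\<^bsub>Y\<^esub> S y) \<and>
    (\<forall>a. \<forall>x\<in>carrier X. S (a \<odot>\<^bsub>X\<^esub> x) = a \<odot>\<^bsub>Y\<^esub> S x)"

definition bounded_operator ::
    "('a, 'c) cnormed_space_scheme \<Rightarrow> ('b, 'd) cnormed_space_scheme \<Rightarrow> ('a \<Rightarrow> 'b) \<Rightarrow> bool" where
  "bounded_operator X Y S \<longleftrightarrow>
    linear_operator X Y S \<and> (\<exists>K. \<forall>x\<in>carrier X. vnorm Y (S x) \<le> K * vnorm X x)"

text \<open>Meaningful for bounded operators only: the supremum of an unbounded set of reals is arbitrary.\<close>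

definition operator_norm ::
    "('a, 'c) cnormed_space_scheme \<Rightarrow> ('b, 'd) cnormed_space_scheme \<Rightarrow> ('a \<Rightarrow> 'b) \<Rightarrow> real" where
  "operator_norm X Y S = (SUP x\<in>{x \<in> carrier X. vnorm X x \<le> 1}. vnorm Y (S x))"

lemma vnorm_le_operator_norm:
  assumes "complex_normed_space X" "complex_normed_space Y" "bounded_operator X Y S" "x \<in> carrier X"
  shows "vnorm Y (S x) \<le> operator_norm X Y S * vnorm X x"
proof -
  interpret X: complex_normed_space X by fact
  interpret Y: complex_normed_space Y by fact
  have S_in: "S z \<in> carrier Y" if "z \<in> carrier X" for z
    using assms(3) that by (auto simp: bounded_operator_def linear_operator_def)
  have S_smult: "S (a \<odot>\<^bsub>X\<^esub> z) = a \<odot>\<^bsub>Y\<^esub> S z" if "z \<in> carrier X" for a z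
    using assms(3) that by (auto simp: bounded_operator_def linear_operator_def)
  obtain K where K: "\<And>z. z \<in> carrier X \<Longrightarrow> vnorm Y (S z) \<le> K * vnorm X z"
    using assms(3) by (auto simp: bounded_operator_def)
  have bdd: "bdd_above ((\<lambda>z. vnorm Y (S z)) ` {z \<in> carrier X. vnorm X z \<le> 1})"
  proof (rule bdd_aboveI2)
    fix z assume z: "z \<in> {z \<in> carrier X. vnorm X z \<le> 1}"
    have "vnorm Y (S z) \<le> K * vnorm X z" using K z by simp
    also have "\<dots> \<le> \<bar>K\<bar> * 1"
      using z X.vnorm_nonneg[of z] by (intro mult_mono) auto
    finally show "vnorm Y (S z) \<le> \<bar>K\<bar>" by simp
  qed
  show ?thesis
  proof (cases "vnorm X x = 0")
    case True
    then show ?thesis using K[OF assms(4)] by simp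
  next
    case False
    define r where "r = vnorm X x"
    have r: "r > 0" using False X.vnorm_nonneg[OF assms(4)] by (simp add: r_def)
    define u where "u = complex_of_real (1 / r) \<odot>\<^bsub>X\<^esub> x"
    have u: "u \<in> carrier X"
      using X.smult_closed[of "complex_of_real (1 / r)" x] assms(4) by (simp add: u_def)
    have "vnorm X u = 1"
      using r by (simp add: u_def X.vnorm_smult[OF assms(4)] norm_divide flip: r_def)
    then have "vnorm Y (S u) \<le> operator_norm X Y S"
      unfolding operator_norm_def using u by (intro cSUP_upper bdd) auto
    moreover have "vnorm Y (S u) = vnorm Y (S x) / r"
      using r by (simp add: u_def S_smult[OF assms(4)] Y.vnorm_smult[OF S_in[OF assms(4)]] norm_divide)
    ultimately show ?thesis using r by (simp add: field_simps flip: r_def)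
  qed
qed

definition dual_space :: "('a, 'c) cnormed_space_scheme \<Rightarrow> ('a \<Rightarrow> complex) set" where
  "dual_space X = {f. bounded_operator X complex_line f}"

definition dual_norm :: "('a, 'c) cnormed_space_scheme \<Rightarrow> ('a \<Rightarrow> complex) \<Rightarrow> real" where
  "dual_norm X f = operator_norm X complex_line f"

definition uniformly_kreiss_bounded ::
    "('a, 'c) cnormed_space_scheme \<Rightarrow> ('a \<Rightarrow> 'a) \<Rightarrow> bool" where
  "uniformly_kreiss_bounded X T \<longleftrightarrow>
    (\<exists>C>0. \<forall>n::nat. \<forall>l::complex. cmod l > 1 \<longrightarrow>
      operator_norm X X
        (\<lambda>x. \<Oplus>\<^bsub>X\<^esub>k\<in>{0..n}. (l powi (- int k - 1)) \<odot>\<^bsub>X\<^esub> (T ^^ k) x)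
      \<le> C / (cmod l - 1))"

definition strongly_cesaro_bounded ::
    "('a, 'c) cnormed_space_scheme \<Rightarrow> ('a \<Rightarrow> 'a) \<Rightarrow> bool" where
  "strongly_cesaro_bounded X T \<longleftrightarrow>
    (\<exists>C>0. \<forall>x\<in>carrier X. \<forall>f\<in>dual_space X. \<forall>N::nat. N \<ge> 1 \<longrightarrow>
      (1 / real N) * (\<Sum>k=0..N-1. cmod (f ((T ^^ k) x))) \<le> C * vnorm X x * dual_norm X f)"

end

theory Submission
  imports Defs
begin

text \<open>
  A bound \<open>O(n)\<close> for the norms of \<open>\<Sum>k<n. \<mu>\<^sup>k T\<^sup>k\<close>, uniform in the unimodular \<open>\<mu>\<close>, implies uniform
  Kreiss boundedness by summation by parts.  Strong Cesaro boundedness asks for the same bound with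
  arbitrary unimodular coefficients in place of \<open>\<mu>\<^sup>k\<close>.  Hence one looks for an operator whose matrix
  entries \<open>\<langle>T\<^sup>k x, y\<rangle>\<close>, as functions of \<open>k\<close>, are large but carry signs that make all the sums
  against \<open>\<mu>\<^sup>k\<close> small; the Rudin--Shapiro signs \<open>\<epsilon>\<^sub>p\<close> have this property, since their sums of
  length \<open>N\<close> against \<open>z\<^sup>p\<close> are bounded by \<open>5 * sqrt N\<close> on the unit circle (\<open>norm_rs_poly_le\<close>).

  The operator acts on two chains of unit vectors \<open>e\<^sub>0, e\<^sub>1, \<dots>\<close> and \<open>f\<^sub>0, f\<^sub>1, \<dots>\<close>.  With
  \<open>w\<^sub>p = (p + 1) powr (3 / 8)\<close> and \<open>u\<^sub>p = (p + 1) powr (1 / 4)\<close> it moves \<open>e\<^sub>j\<close> upwards with factor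
  \<open>w\<^sub>j\<^sub>+\<^sub>1 / w\<^sub>j\<close>, moves \<open>f\<^sub>i\<^sub>+\<^sub>1\<close> downwards with factor \<open>w\<^sub>i\<^sub>+\<^sub>1 / w\<^sub>i\<close>, and sends \<open>e\<^sub>p\<close> to \<open>f\<^sub>p\<close> with
  coefficient \<open>\<epsilon>\<^sub>p u\<^sub>p / w\<^sub>p\<^sup>2\<close>.  A vector starting at \<open>e\<^sub>j\<close> and crossing at \<open>p\<close> reaches \<open>f\<^sub>i\<close> at time
  \<open>2 * p + 1 - i - j\<close> with coefficient \<open>\<epsilon>\<^sub>p u\<^sub>p / (w\<^sub>i w\<^sub>j)\<close>.  For \<open>i = j = 0\<close> these coefficients have
  the unbounded moduli \<open>u\<^sub>p\<close>, which contradicts strong Cesaro boundedness.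

  In \<open>\<Sum>k<n. \<mu>\<^sup>k T\<^sup>k\<close> the entry from \<open>e\<^sub>j\<close> to \<open>f\<^sub>i\<close> is a Rudin--Shapiro sum with weights \<open>u\<^sub>p\<close> over
  an interval of crossing places \<open>p\<close>.  It vanishes unless \<open>\<bar>i - j\<bar> < n\<close>, and summation by parts bounds it by a multiple
  of \<open>W / (w\<^sub>i w\<^sub>j)\<close> with \<open>W = (max i j + n + 1) powr (3 / 4)\<close>, because \<open>sqrt p * u\<^sub>p \<le> w\<^sub>p\<^sup>2\<close>
  (\<open>corner_coefficient_le\<close>).  The entries within the two chains obey the same bound.  The norm of
  the resulting nonnegative kernel is \<open>O(n)\<close> (\<open>band_kernel_bound\<close>): it is dominated by
  \<open>3\<close> times the sum of the band matrix \<open>\<bar>i - j\<bar> < n\<close> and of \<open>n powr (3 / 4)\<close> times the rank one matrix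
  with entries \<open>1 / (w\<^sub>i w\<^sub>j)\<close> for \<open>i, j < 2 * n\<close>, whose norm \<open>\<Sum>i<2 * n. 1 / w\<^sub>i\<^sup>2\<close> has order \<open>n powr (1 / 4)\<close>.
\<close>

section \<open>The Rudin--Shapiro sequence\<close>

text \<open>The Rudin--Shapiro signs \<open>\<epsilon>\<^sub>n\<close>, given by \<open>\<epsilon>\<^sub>2\<^sub>n = \<epsilon>\<^sub>n\<close> and
  \<open>\<epsilon>\<^sub>2\<^sub>n\<^sub>+\<^sub>1 = (-1)\<^sup>n \<epsilon>\<^sub>n\<close>, as complex numbers.\<close>

fun rudin_shapiro :: "nat \<Rightarrow> complex" where
  "rudin_shapiro n =
    (if n = 0 then 1
     else if even n then rudin_shapiro (n div 2)
     else (-1) ^ (n div 2) * rudin_shapiro (n div 2))"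

declare rudin_shapiro.simps [simp del]

lemma rudin_shapiro_0 [simp]: "rudin_shapiro 0 = 1"
  by (simp add: rudin_shapiro.simps)

lemma rudin_shapiro_even: "rudin_shapiro (2 * n) = rudin_shapiro n"
  by (cases "n = 0") (auto simp: rudin_shapiro.simps[of "2 * n"])

lemma rudin_shapiro_odd: "rudin_shapiro (Suc (2 * n)) = (-1) ^ n * rudin_shapiro n"
  by (simp add: rudin_shapiro.simps[of "Suc (2 * n)"])

lemma norm_rudin_shapiro [simp]: "cmod (rudin_shapiro n) = 1"
proof (induction n rule: less_induct)
  case (less n)
  show ?case
    using less[of "n div 2"]
    by (cases "n = 0") (auto simp: rudin_shapiro.simps[of n] norm_mult norm_power)
qed

text \<open>The polynomial whose coefficients are the first \<open>N\<close> signs, for every \<open>N\<close> and not only for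
  powers of two.\<close>

definition rs_poly :: "nat \<Rightarrow> complex \<Rightarrow> complex" where
  "rs_poly N z = (\<Sum>p<N. rudin_shapiro p * z ^ p)"

lemma rs_poly_double: "rs_poly (2 * N) z = rs_poly N (z\<^sup>2) + z * rs_poly N (- (z\<^sup>2))"
proof (induction N)
  case (Suc N)
  have "rs_poly (2 * Suc N) z = rs_poly (2 * N) z + rudin_shapiro N * z ^ (2 * N)
      + z * ((-1) ^ N * rudin_shapiro N * z ^ (2 * N))"
    by (simp add: rs_poly_def rudin_shapiro_even rudin_shapiro_odd)
  moreover have "(z\<^sup>2) ^ N = z ^ (2 * N)"
    by (simp only: power_mult)
  moreover have "(- (z\<^sup>2)) ^ N = (-1) ^ N * z ^ (2 * N)"
    by (simp only: power_minus[of "z\<^sup>2"] power_mult)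
  ultimately show ?case
    using Suc by (simp add: rs_poly_def distrib_left mult_ac)
qed (simp add: rs_poly_def)

text \<open>The values at \<open>z\<close> and \<open>- z\<close> together, because doubling \<open>N\<close> acts on this pair as \<open>sqrt 2\<close> times
  an isometry when \<open>z\<close> is unimodular.\<close>

definition rs_pair :: "nat \<Rightarrow> complex \<Rightarrow> complex \<times> complex" where
  "rs_pair N z = (rs_poly N z, rs_poly N (- z))"

lemma norm_rs_pair_double:
  assumes "cmod z = 1"
  shows "norm (rs_pair (2 * N) z) = sqrt 2 * norm (rs_pair N (z\<^sup>2))"
proof -
  define a b where "a = rs_poly N (z\<^sup>2)" and "b = z * rs_poly N (- (z\<^sup>2))"
  have nb: "cmod b = cmod (rs_poly N (- (z\<^sup>2)))"
    using assms by (simp add: b_def norm_mult)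
  have par: "(cmod (a + b))\<^sup>2 + (cmod (a - b))\<^sup>2 = 2 * ((cmod a)\<^sup>2 + (cmod b)\<^sup>2)"
    by (simp only: cmod_power2 plus_complex.sel minus_complex.sel)
      (simp add: power2_eq_square algebra_simps)
  have "rs_pair (2 * N) z = (a + b, a - b)"
    by (simp add: rs_pair_def rs_poly_double a_def b_def)
  moreover have "norm (rs_pair N (z\<^sup>2)) = sqrt ((cmod a)\<^sup>2 + (cmod b)\<^sup>2)"
    by (simp add: rs_pair_def norm_Pair nb a_def)
  ultimately show ?thesis
    using par by (simp only: norm_Pair real_sqrt_mult)
qed

lemma norm_rs_pair_Suc:
  assumes "cmod z = 1"
  shows "norm (rs_pair (Suc N) z) \<le> norm (rs_pair N z) + sqrt 2"
proof -
  have "rs_pair (Suc N) z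
      = rs_pair N z + (rudin_shapiro N * z ^ N, rudin_shapiro N * (- z) ^ N)"
    by (simp add: rs_pair_def rs_poly_def)
  moreover have "norm (rudin_shapiro N * z ^ N, rudin_shapiro N * (- z) ^ N) = sqrt 2"
    using assms by (simp add: norm_Pair norm_mult norm_power)
  ultimately show ?thesis
    by (metis norm_triangle_ineq)
qed

text \<open>The negative constant makes the induction on the binary digits of \<open>N\<close> close: an odd digit adds
  \<open>sqrt 2\<close>, while doubling turns \<open>- 7 / 2\<close> into \<open>- 7 / 2 * sqrt 2\<close>, and \<open>5 / 2 * sqrt 2 \<ge> 7 / 2\<close>.\<close>

lemma norm_rs_pair_le:
  assumes "cmod z = 1" "N \<ge> 1"
  shows "norm (rs_pair N z) \<le> 5 * sqrt N - 7 / 2"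
  using assms
proof (induction N arbitrary: z rule: less_induct)
  case (less N)
  have s2: "sqrt 2 \<le> 3 / 2" "7 / 5 \<le> sqrt 2"
    by (rule real_le_lsqrt real_le_rsqrt; simp add: power2_eq_square)+
  show ?case
  proof (cases "N = 1")
    case True
    then show ?thesis
      using s2 by (simp add: rs_pair_def rs_poly_def norm_Pair)
  next
    case False
    define m where "m = N div 2"
    have m: "m \<ge> 1" "m < N"
      using False less.prems by (auto simp: m_def)
    have z2: "cmod (z\<^sup>2) = 1"
      using less.prems by (simp add: norm_power)
    have "norm (rs_pair (2 * m) z) \<le> sqrt 2 * (5 * sqrt m - 7 / 2)"
      using less.IH[OF m(2) z2 m(1)] norm_rs_pair_double[OF less.prems(1), of m] by simp
    also have "\<dots> = 5 * sqrt (2 * m) - 7 / 2 * sqrt 2"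
      by (simp add: real_sqrt_mult algebra_simps)
    finally have *: "norm (rs_pair (2 * m) z) \<le> 5 * sqrt (2 * m) - 7 / 2 * sqrt 2" .
    show ?thesis
    proof (cases "even N")
      case True
      then show ?thesis
        using * s2 by (simp add: m_def)
    next
      case False
      then have N: "N = Suc (2 * m)"
        by (simp add: m_def)
      have "norm (rs_pair N z) \<le> 5 * sqrt (2 * m) - 5 / 2 * sqrt 2"
        using norm_rs_pair_Suc[OF less.prems(1), of "2 * m"] * unfolding N by simp
      moreover have "sqrt (2 * m) \<le> sqrt N"
        by (simp add: N)
      ultimately show ?thesis
        using s2 by linarith
    qed
  qed
qed

lemma norm_rs_poly_le:
  assumes "cmod z = 1"
  shows "cmod (rs_poly N z) \<le> 5 * sqrt N"
proof (cases "N = 0")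
  case False
  have "cmod (rs_poly N z) \<le> norm (rs_pair N z)"
    unfolding rs_pair_def by (metis norm_fst_le fst_conv)
  with norm_rs_pair_le[OF assms, of N] False show ?thesis by simp
qed (simp add: rs_poly_def)

lemma sum_by_parts_norm_le:
  fixes d :: "nat \<Rightarrow> complex" and u :: "nat \<Rightarrow> real"
  assumes "mono u" "\<And>p. 0 \<le> u p" and B: "\<And>m. m \<le> b \<Longrightarrow> cmod (\<Sum>p<m. d p) \<le> B"
  shows "cmod (\<Sum>p<b. d p * of_real (u p)) \<le> 2 * B * u b"
proof -
  have parts: "(\<Sum>p<c. d p * of_real (u p))
      = (\<Sum>p<c. d p) * of_real (u c) - (\<Sum>q<c. (\<Sum>p<Suc q. d p) * of_real (u (Suc q) - u q))" for c
    by (induction c) (simp_all add: algebra_simps)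
  have "B \<ge> 0" using B[of 0] by simp
  have "cmod (\<Sum>q<b. (\<Sum>p<Suc q. d p) * of_real (u (Suc q) - u q))
      \<le> (\<Sum>q<b. B * (u (Suc q) - u q))"
  proof (rule sum_norm_le)
    fix q assume "q \<in> {..<b}"
    then show "cmod ((\<Sum>p<Suc q. d p) * of_real (u (Suc q) - u q)) \<le> B * (u (Suc q) - u q)"
      using B[of "Suc q"] monoD[OF assms(1), of q "Suc q"]
      unfolding norm_mult norm_of_real using \<open>B \<ge> 0\<close> by (intro mult_mono) auto
  qed
  also have "\<dots> = B * (u b - u 0)"
    by (simp add: sum_lessThan_telescope flip: sum_distrib_left)
  also have "\<dots> \<le> B * u b"
    using \<open>B \<ge> 0\<close> assms(2)[of 0] by (intro mult_left_mono) auto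
  finally have 1: "cmod (\<Sum>q<b. (\<Sum>p<Suc q. d p) * of_real (u (Suc q) - u q)) \<le> B * u b" .
  have "cmod ((\<Sum>p<b. d p) * of_real (u b)) \<le> B * u b"
    using B[of b] assms(2)[of b] \<open>B \<ge> 0\<close> unfolding norm_mult norm_of_real by (intro mult_mono) auto
  with 1 show ?thesis
    unfolding parts[of b] by (intro norm_triangle_le_diff) simp
qed

section \<open>The weights and the dominating kernel\<close>

text \<open>The weight along the chains.  The exponent lies strictly between \<open>1 / 4\<close> and \<open>1 / 2\<close>: below
  \<open>1 / 2\<close> the sums of \<open>1 / (weight j)\<^sup>2\<close> over \<open>j < n\<close> have order \<open>n / (weight n)\<^sup>2\<close>, and above
  \<open>1 / 4\<close> the quotients \<open>(weight p)\<^sup>2 / sqrt p\<close> are unbounded.\<close>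

definition weight :: "nat \<Rightarrow> real" where
  "weight p = (real p + 1) powr (3 / 8)"

text \<open>The amplitude of the coupling, of order \<open>(weight p)\<^sup>2 / sqrt p\<close>; the factor \<open>sqrt p\<close> is what the
  cancellation in the Rudin--Shapiro sums gains.\<close>

definition amp :: "nat \<Rightarrow> real" where
  "amp p = (real p + 1) powr (1 / 4)"

lemma weight_pos [simp]: "weight p > 0" by (simp add: weight_def)

lemma weight_nonneg [simp]: "weight p \<ge> 0" by (simp add: weight_def)

lemma weight_0 [simp]: "weight 0 = 1" by (simp add: weight_def)

lemma weight_mono: "p \<le> q \<Longrightarrow> weight p \<le> weight q"
  by (simp add: weight_def powr_mono2)

lemma weight_sq: "(weight p)\<^sup>2 = (real p + 1) powr (3 / 4)"
  by (simp add: weight_def power2_eq_square flip: powr_add)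

lemma amp_mono: "mono amp"
  by (auto simp: mono_def amp_def intro: powr_mono2)

lemma amp_nonneg [simp]: "0 \<le> amp p" by (simp add: amp_def)

lemma rs_interval_sum_le:
  assumes "cmod z = 1" "a \<le> b"
  shows "cmod (\<Sum>p\<in>{a..<b}. rudin_shapiro p * z ^ p * of_real (amp p)) \<le> 20 * (weight b)\<^sup>2"
proof -
  have pre: "cmod (\<Sum>p<c. rudin_shapiro p * z ^ p * of_real (amp p)) \<le> 10 * (weight b)\<^sup>2"
    if "c \<le> b" for c
  proof -
    have "cmod (\<Sum>p<m. rudin_shapiro p * z ^ p) \<le> 5 * sqrt b" if "m \<le> c" for m
    proof -
      have "sqrt m \<le> sqrt b" using that \<open>c \<le> b\<close> by simp
      moreover have "cmod (\<Sum>p<m. rudin_shapiro p * z ^ p) \<le> 5 * sqrt m"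
        using norm_rs_poly_le[OF assms(1), of m] by (simp add: rs_poly_def)
      ultimately show ?thesis by linarith
    qed
    then have "cmod (\<Sum>p<c. rudin_shapiro p * z ^ p * of_real (amp p)) \<le> 2 * (5 * sqrt b) * amp c"
      by (intro sum_by_parts_norm_le amp_mono) auto
    also have "\<dots> \<le> 10 * ((real b + 1) powr (1 / 2) * (real b + 1) powr (1 / 4))"
    proof -
      have "sqrt b \<le> (real b + 1) powr (1 / 2)" by (simp add: powr_half_sqrt)
      moreover have "amp c \<le> (real b + 1) powr (1 / 4)"
        using monoD[OF amp_mono that] by (simp add: amp_def)
      ultimately have "sqrt b * amp c \<le> (real b + 1) powr (1 / 2) * (real b + 1) powr (1 / 4)"
        by (intro mult_mono) auto
      then show ?thesis by simp
    qed
    also have "\<dots> = 10 * (weight b)\<^sup>2"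
      by (simp add: weight_sq flip: powr_add)
    finally show ?thesis .
  qed
  have "(\<Sum>p\<in>{a..<b}. rudin_shapiro p * z ^ p * of_real (amp p))
     = (\<Sum>p<b. rudin_shapiro p * z ^ p * of_real (amp p))
       - (\<Sum>p<a. rudin_shapiro p * z ^ p * of_real (amp p))"
    unfolding lessThan_atLeast0 by (rule sum_diff_nat_ivl[symmetric]) (use assms(2) in auto)
  then have "cmod (\<Sum>p\<in>{a..<b}. rudin_shapiro p * z ^ p * of_real (amp p))
      \<le> cmod (\<Sum>p<b. rudin_shapiro p * z ^ p * of_real (amp p))
        + cmod (\<Sum>p<a. rudin_shapiro p * z ^ p * of_real (amp p))"
    by (simp only: norm_triangle_ineq4)
  also have "\<dots> \<le> 20 * (weight b)\<^sup>2"
    using pre[OF assms(2)] pre[of b] by simp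
  finally show ?thesis .
qed

lemma sum_inverse_weight_sq_le:
  "(\<Sum>j<M. 1 / (weight j)\<^sup>2) \<le> 4 * real M powr (1 / 4)"
proof (induction M)
  case (Suc M)
  define a b where "a = real (Suc M) powr (1 / 4)" and "b = real M powr (1 / 4)"
  have ab: "0 \<le> b" "b \<le> a" "0 < a"
    by (auto simp: a_def b_def intro: powr_mono2)
  have "a ^ 4 = real (Suc M)" "b ^ 4 = real M"
    by (auto simp: a_def b_def powr_powr simp flip: powr_numeral)
  then have "1 = a ^ 4 - b ^ 4" by simp
  also have "\<dots> = (a - b) * (a ^ 3 + a\<^sup>2 * b + a * b\<^sup>2 + b ^ 3)"
    by (simp add: algebra_simps power2_eq_square power3_eq_cube power4_eq_xxxx)
  also have "\<dots> \<le> (a - b) * (a ^ 3 + a\<^sup>2 * a + a * a\<^sup>2 + a ^ 3)"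
    using ab by (intro mult_left_mono add_mono power_mono mult_mono) auto
  also have "\<dots> = 4 * (a - b) * a ^ 3"
    by (simp add: power2_eq_square power3_eq_cube)
  finally have "1 / a ^ 3 \<le> 4 * (a - b)"
    using ab by (simp add: field_simps)
  moreover have "(weight M)\<^sup>2 = a ^ 3"
    by (simp add: weight_sq a_def powr_powr add.commute flip: powr_numeral)
  ultimately show ?case
    using Suc by (simp add: a_def b_def)
qed simp

text \<open>Up to constant factors, this nonnegative kernel dominates all the matrix blocks of the sums
  \<open>\<Sum>k<n. \<mu>\<^sup>k T\<^sup>k\<close> with unimodular \<open>\<mu>\<close>, where \<open>T\<close> is the operator constructed below.\<close>

definition band_kernel :: "nat \<Rightarrow> nat \<Rightarrow> nat \<Rightarrow> real" where
  "band_kernel n i j =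
    (if i < j + n \<and> j < i + n then (weight (max i j + n))\<^sup>2 / (weight i * weight j) else 0)"

lemma band_kernel_nonneg: "0 \<le> band_kernel n i j"
  by (simp add: band_kernel_def less_imp_le)

lemma band_kernel_ge_ratio:
  assumes "i < j + n" "j < i + n"
  shows "weight i / weight j \<le> band_kernel n i j"
proof -
  have "weight i / weight j = (weight i * weight i) / (weight i * weight j)"
    using weight_pos[of i] by (simp add: less_imp_neq[symmetric])
  also have "\<dots> \<le> (weight (max i j + n) * weight (max i j + n)) / (weight i * weight j)"
    by (intro divide_right_mono mult_mono weight_mono mult_nonneg_nonneg) auto
  finally show ?thesis using assms by (simp add: band_kernel_def power2_eq_square)
qed

lemma band_kernel_commute: "band_kernel n i j = band_kernel n j i"
  by (simp add: band_kernel_def max.commute mult.commute conj_commute)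

text \<open>Away from the corner \<open>i, j < 2 * n\<close> the weights in the kernel are comparable, so the kernel is
  bounded by a band matrix; in the corner it is bounded by a matrix of rank one.\<close>

lemma band_kernel_le:
  assumes "n \<ge> 1"
  shows "band_kernel n i j \<le> 3 * of_bool (i < j + n \<and> j < i + n)
    + 3 * real n powr (3 / 4) * (of_bool (i < 2 * n) / weight i) * (of_bool (j < 2 * n) / weight j)"
proof (cases "i < j + n \<and> j < i + n")
  case band: True
  have three: "(3::real) powr (3 / 4) \<le> 3"
    using powr_mono[of "3 / 4" 1 "3::real"] by simp
  show ?thesis
  proof (cases "n \<le> min i j")
    case True
    have "(weight (max i j + n))\<^sup>2 \<le> (3 * (real (min i j) + 1)) powr (3 / 4)"
      unfolding weight_sq using band True by (intro powr_mono2) auto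
    also have "\<dots> \<le> 3 * (weight (min i j))\<^sup>2"
      unfolding powr_mult weight_sq using three by (intro mult_right_mono) auto
    also have "\<dots> \<le> 3 * (weight i * weight j)"
      unfolding power2_eq_square
      by (intro mult_left_mono mult_mono weight_mono mult_nonneg_nonneg) auto
    finally have "band_kernel n i j \<le> 3"
      using band by (simp add: band_kernel_def field_simps)
    then show ?thesis using band by (auto intro: add_increasing2 simp: less_imp_le)
  next
    case False
    then have small: "i < 2 * n" "j < 2 * n" using band by auto
    have "(weight (max i j + n))\<^sup>2 \<le> (3 * real n) powr (3 / 4)"
      unfolding weight_sq using band False by (intro powr_mono2) auto
    also have "\<dots> \<le> 3 * real n powr (3 / 4)"
      unfolding powr_mult using three by (intro mult_right_mono) auto
    finally have "band_kernel n i j \<le> 3 * real n powr (3 / 4) / (weight i * weight j)"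
      using band by (simp add: band_kernel_def divide_right_mono less_imp_le)
    moreover have "3 * real n powr (3 / 4) / (weight i * weight j)
      = 3 * real n powr (3 / 4) * (of_bool (i < 2 * n) / weight i) * (of_bool (j < 2 * n) / weight j)"
      using small by simp
    moreover have "(0::real) \<le> 3 * of_bool (i < j + n \<and> j < i + n)" by simp
    ultimately show ?thesis by linarith
  qed
next
  case False
  then have "band_kernel n i j = 0" by (auto simp: band_kernel_def)
  then show ?thesis by simp
qed

lemma L2_set_sum_le:
  fixes f :: "'i \<Rightarrow> 'j \<Rightarrow> real"
  shows "L2_set (\<lambda>i. \<Sum>j\<in>J. f j i) A \<le> (\<Sum>j\<in>J. L2_set (f j) A)"
proof (induction J rule: infinite_finite_induct)
  case (insert j J)
  then show ?case
    using L2_set_triangle_ineq[of "f j" "\<lambda>i. \<Sum>j\<in>J. f j i" A] by simp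
qed (simp_all add: L2_set_0')

text \<open>Schur's test for the band: its rows and columns have at most \<open>2 * n\<close> entries.\<close>

lemma band_sum_bound:
  fixes a :: "nat \<Rightarrow> real"
  assumes A: "\<And>M. L2_set a {..<M} \<le> A" 
  shows "L2_set (\<lambda>i. \<Sum>j<i + n. of_bool (i < j + n \<and> j < i + n) * a j) {..<M} \<le> 2 * n * A"
proof -
  have A0: "0 \<le> A" using A[of 0] by simp
  define b :: "nat \<Rightarrow> nat \<Rightarrow> real" where "b = (\<lambda>i j. of_bool (i < j + n \<and> j < i + n))"
  have bb: "b i j * b i j = b i j" "0 \<le> b i j" "b i j = b j i" for i j by (auto simp: b_def)
  have row: "(\<Sum>j<L. b i j) \<le> 2 * n" for i L
  proof -
    have "(\<Sum>j<L. b i j) = real (card {j. j < L \<and> i < j + n \<and> j < i + n})"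
      by (simp add: b_def flip: sum.inter_filter) (simp add: Int_def)
    also have "\<dots> \<le> real (card {i - n..<i + n})"
      by (intro of_nat_mono card_mono) auto
    also have "\<dots> \<le> 2 * n" by simp
    finally show ?thesis .
  qed
  have "(\<Sum>i<M. (\<Sum>j<i + n. b i j * a j)\<^sup>2) \<le> (\<Sum>i<M. 2 * n * (\<Sum>j<M + n. b i j * (a j)\<^sup>2))"
  proof (rule sum_mono)
    fix i assume i: "i \<in> {..<M}"
    \<comment> \<open>the entries of \<open>b\<close> are \<open>0\<close> or \<open>1\<close>; one factor is kept for counting, one for restricting \<open>a\<close>\<close>
    have "(\<Sum>j<i + n. b i j * a j)\<^sup>2 = (\<Sum>j<i + n. b i j * (b i j * a j))\<^sup>2"
      by (simp add: bb flip: mult.assoc)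
    also have "\<dots> \<le> (\<Sum>j<i + n. (b i j)\<^sup>2) * (\<Sum>j<i + n. (b i j * a j)\<^sup>2)"
      by (rule Cauchy_Schwarz_ineq_sum)
    also have "\<dots> = (\<Sum>j<i + n. b i j) * (\<Sum>j<i + n. b i j * (a j)\<^sup>2)"
      by (simp add: bb power_mult_distrib) (simp add: power2_eq_square bb)
    also have "\<dots> \<le> 2 * n * (\<Sum>j<M + n. b i j * (a j)\<^sup>2)"
      using i by (intro mult_mono row sum_mono2) (auto simp: bb intro!: sum_nonneg)
    finally show "(\<Sum>j<i + n. b i j * a j)\<^sup>2 \<le> 2 * n * (\<Sum>j<M + n. b i j * (a j)\<^sup>2)" .
  qed
  also have "\<dots> = 2 * n * (\<Sum>j<M + n. (\<Sum>i<M. b j i) * (a j)\<^sup>2)"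
  proof -
    have "(\<Sum>i<M. \<Sum>j<M + n. b i j * (a j)\<^sup>2) = (\<Sum>j<M + n. \<Sum>i<M. b j i * (a j)\<^sup>2)"
      by (subst sum.swap) (simp add: bb(3))
    then show ?thesis
      by (simp flip: sum_distrib_left sum_distrib_right)
  qed
  also have "\<dots> \<le> 2 * n * (\<Sum>j<M + n. (2 * n) * (a j)\<^sup>2)"
    by (intro mult_left_mono sum_mono mult_right_mono row) auto
  also have "\<dots> = (2 * n)\<^sup>2 * (L2_set a {..<M + n})\<^sup>2"
    by (simp add: L2_set_def sum_nonneg power2_eq_square mult.assoc flip: sum_distrib_left)
  also have "\<dots> \<le> (2 * n)\<^sup>2 * A\<^sup>2"
    by (intro mult_left_mono power_mono A) auto
  finally show ?thesis
    using A0 unfolding L2_set_def b_def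
    by (intro real_le_lsqrt) (auto simp: power_mult_distrib)
qed

text \<open>The kernel has norm \<open>O(n)\<close> on square summable sequences: the band contributes \<open>3 * 2 * n\<close>, and the
  rank one part \<open>3 * n powr (3 / 4)\<close> times the sum of \<open>1 / (weight i)\<^sup>2\<close> over \<open>i < 2 * n\<close>.\<close>

lemma band_kernel_bound:
  assumes n: "n \<ge> 1" and A: "\<And>M. L2_set a {..<M} \<le> A" and a: "\<And>j. 0 \<le> a j"
  shows "L2_set (\<lambda>i. \<Sum>j<i + n. band_kernel n i j * a j) {..<M} \<le> 30 * n * A"
proof -
  define h :: "nat \<Rightarrow> real" where "h = (\<lambda>i. of_bool (i < 2 * n) / weight i)"
  have h0: "0 \<le> h i" for i by (simp add: h_def less_imp_le)
  define c where "c = 3 * real n powr (3 / 4)"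
  have c0: "0 \<le> c" by (simp add: c_def)
  have A0: "0 \<le> A" using A[of 0] by simp
  define q where "q = 4 * (2 * real n) powr (1 / 4)"
  have h2: "L2_set h {..<L} \<le> sqrt q" for L
  proof -
    have "(\<Sum>i<L. (h i)\<^sup>2) \<le> (\<Sum>i<L. of_bool (i < 2 * n) * (1 / (weight i)\<^sup>2))"
      by (intro sum_mono) (auto simp: h_def power_divide)
    also have "\<dots> \<le> (\<Sum>i<2 * n. 1 / (weight i)\<^sup>2)"
    proof -
      have "(\<Sum>i<L. of_bool (i < 2 * n) * (1 / (weight i)\<^sup>2))
          = (\<Sum>i\<in>{..<L} \<inter> {..<2 * n}. 1 / (weight i)\<^sup>2)"
        by (auto simp: sum.inter_restrict intro!: sum.cong)
      also have "\<dots> \<le> (\<Sum>i<2 * n. 1 / (weight i)\<^sup>2)"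
        by (intro sum_mono2) auto
      finally show ?thesis .
    qed
    also have "\<dots> \<le> q" using sum_inverse_weight_sq_le[of "2 * n"] by (simp add: q_def)
    finally show ?thesis by (simp add: L2_set_def)
  qed
  define s where "s = sqrt q * A"
  have hs: "(\<Sum>j<L. h j * a j) \<le> s" for L
  proof -
    have "(\<Sum>j<L. h j * a j) \<le> L2_set h {..<L} * L2_set a {..<L}"
      using L2_set_mult_ineq[of h a "{..<L}"] h0 a by (simp add: abs_of_nonneg)
    also have "\<dots> \<le> s" unfolding s_def by (intro mult_mono h2 A) (auto simp: q_def)
    finally show ?thesis .
  qed
  have s0: "0 \<le> s" by (simp add: s_def A0 q_def)
  have "(\<Sum>j<i + n. band_kernel n i j * a j)
      \<le> 3 * (\<Sum>j<i + n. of_bool (i < j + n \<and> j < i + n) * a j) + c * s * h i" for i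
  proof -
    have "(\<Sum>j<i + n. band_kernel n i j * a j)
      \<le> (\<Sum>j<i + n. (3 * of_bool (i < j + n \<and> j < i + n) + c * h i * h j) * a j)"
      using band_kernel_le[OF n, of i] unfolding c_def h_def by (intro sum_mono mult_right_mono a)
    also have "\<dots> = 3 * (\<Sum>j<i + n. of_bool (i < j + n \<and> j < i + n) * a j)
        + c * h i * (\<Sum>j<i + n. h j * a j)"
      unfolding distrib_right sum.distrib sum_distrib_left mult.assoc ..
    also have "\<dots> \<le> 3 * (\<Sum>j<i + n. of_bool (i < j + n \<and> j < i + n) * a j) + c * h i * s"
      by (intro add_left_mono mult_left_mono hs) (simp add: c0 h0)
    finally show ?thesis by (simp add: mult_ac)
  qed
  then have "L2_set (\<lambda>i. \<Sum>j<i + n. band_kernel n i j * a j) {..<M}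
      \<le> L2_set (\<lambda>i. 3 * (\<Sum>j<i + n. of_bool (i < j + n \<and> j < i + n) * a j) + c * s * h i) {..<M}"
    by (intro L2_set_mono) (auto intro!: sum_nonneg mult_nonneg_nonneg a band_kernel_nonneg)
  also have "\<dots> \<le> 3 * L2_set (\<lambda>i. \<Sum>j<i + n. of_bool (i < j + n \<and> j < i + n) * a j) {..<M}
       + (c * s) * L2_set h {..<M}"
    using L2_set_triangle_ineq by (simp add: L2_set_right_distrib c0 s0)
  also have "\<dots> \<le> 3 * (2 * n * A) + c * s * sqrt q"
    using band_sum_bound[OF A, of n M] h2[of M] by (intro add_mono mult_left_mono) (simp_all only: c0 s0 mult_nonneg_nonneg)
  also have "c * s * sqrt q = c * q * A" by (simp add: s_def q_def)
  also have "c * q * A \<le> 24 * n * A"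
  proof (rule mult_right_mono[OF _ A0])
    have "c * q = 12 * 2 powr (1 / 4) * (real n powr (3 / 4) * real n powr (1 / 4))"
      by (simp add: c_def q_def powr_mult)
    also have "\<dots> = 12 * 2 powr (1 / 4) * n"
      using n by (simp flip: powr_add)
    also have "\<dots> \<le> 12 * 2 * real n"
      using powr_mono[of "1 / 4" 1 "2::real"] by (intro mult_right_mono mult_left_mono) auto
    finally show "c * q \<le> 24 * n" by simp
  qed
  finally show ?thesis by (simp add: mult_ac)
qed

section \<open>The Hilbert space of square summable sequences\<close>

text \<open>The inner product is linear in its first argument.  The fields \<open>mult\<close> and \<open>one\<close> carry no meaning
  for vectors; they are filled with the pointwise operations.\<close>

definition ell2 :: "(nat \<Rightarrow> complex) cinner_space" where
  "ell2 =
    \<lparr>carrier = {x. summable (\<lambda>n. (cmod (x n))\<^sup>2)},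
     monoid.mult = (\<lambda>x y n. x n * y n), one = (\<lambda>n. 1),
     ring.zero = (\<lambda>n. 0), add = (\<lambda>x y n. x n + y n), smult = (\<lambda>a x n. a * x n),
     vnorm = (\<lambda>x. sqrt (\<Sum>n. (cmod (x n))\<^sup>2)),
     cinner = (\<lambda>x y. \<Sum>n. x n * cnj (y n))\<rparr>"

lemma ell2_simps [simp]:
  "\<zero>\<^bsub>ell2\<^esub> = (\<lambda>n. 0)"
  "x \<oplus>\<^bsub>ell2\<^esub> y = (\<lambda>n. x n + y n)"
  "a \<odot>\<^bsub>ell2\<^esub> x = (\<lambda>n. a * x n)"
  by (simp_all add: ell2_def)

lemma in_carrier_ell2: "x \<in> carrier ell2 \<longleftrightarrow> summable (\<lambda>n. (cmod (x n))\<^sup>2)"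
  by (simp add: ell2_def)

lemma vnorm_ell2: "vnorm ell2 x = sqrt (\<Sum>n. (cmod (x n))\<^sup>2)"
  by (simp add: ell2_def)

lemma cinner_ell2: "cinner ell2 x y = (\<Sum>n. x n * cnj (y n))"
  by (simp add: ell2_def)

lemma L2_set_le_vnorm:
  assumes "x \<in> carrier ell2"
  shows "L2_set (\<lambda>n. cmod (x n)) {..<M} \<le> vnorm ell2 x"
  using assms unfolding L2_set_def vnorm_ell2 in_carrier_ell2
  by (intro real_sqrt_le_mono sum_le_suminf) auto

text \<open>Norms are compared through the norms of initial segments: a bound for all of them gives
  membership in the space together with a bound for the norm.\<close>

lemma vnorm_ell2_le:
  assumes "\<And>M. L2_set (\<lambda>n. cmod (x n)) {..<M} \<le> B"
  shows "x \<in> carrier ell2" "vnorm ell2 x \<le> B"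
proof -
  have B: "0 \<le> B" using assms[of 0] by simp
  have le: "(\<Sum>n<M. (cmod (x n))\<^sup>2) \<le> B\<^sup>2" for M
    using assms[of M] B unfolding L2_set_def by (simp add: real_sqrt_le_iff' sqrt_le_D)
  have s: "summable (\<lambda>n. (cmod (x n))\<^sup>2)"
    by (rule summableI_nonneg_bounded[OF _ le]) simp
  then show "x \<in> carrier ell2" by (simp add: in_carrier_ell2)
  have "(\<Sum>n. (cmod (x n))\<^sup>2) \<le> B\<^sup>2"
    by (rule suminf_le_const[OF s le])
  then show "vnorm ell2 x \<le> B"
    unfolding vnorm_ell2 using B real_le_lsqrt by blast
qed

lemma cmod_le_vnorm_ell2: "x \<in> carrier ell2 \<Longrightarrow> cmod (x n) \<le> vnorm ell2 x"
  using L2_set_le_vnorm[of x "Suc n"] member_le_L2_set[of "{..<Suc n}" n "\<lambda>n. cmod (x n)"] by simp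

lemma ell2_add:
  assumes "x \<in> carrier ell2" "y \<in> carrier ell2"
  shows "(\<lambda>n. x n + y n) \<in> carrier ell2"
    "vnorm ell2 (\<lambda>n. x n + y n) \<le> vnorm ell2 x + vnorm ell2 y"
proof -
  have "L2_set (\<lambda>n. cmod (x n + y n)) {..<M} \<le> vnorm ell2 x + vnorm ell2 y" for M
  proof -
    have "L2_set (\<lambda>n. cmod (x n + y n)) {..<M} \<le> L2_set (\<lambda>n. cmod (x n) + cmod (y n)) {..<M}"
      by (intro L2_set_mono norm_triangle_ineq) simp
    also have "\<dots> \<le> L2_set (\<lambda>n. cmod (x n)) {..<M} + L2_set (\<lambda>n. cmod (y n)) {..<M}"
      by (rule L2_set_triangle_ineq)
    finally show ?thesis
      using L2_set_le_vnorm[OF assms(1), of M] L2_set_le_vnorm[OF assms(2), of M] by linarith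
  qed
  from vnorm_ell2_le[OF this]
  show "(\<lambda>n. x n + y n) \<in> carrier ell2"
    "vnorm ell2 (\<lambda>n. x n + y n) \<le> vnorm ell2 x + vnorm ell2 y" .
qed

lemma ell2_smult:
  assumes "x \<in> carrier ell2"
  shows "(\<lambda>n. a * x n) \<in> carrier ell2" "vnorm ell2 (\<lambda>n. a * x n) = cmod a * vnorm ell2 x"
  using assms unfolding in_carrier_ell2 vnorm_ell2
  by (simp_all add: norm_mult power_mult_distrib summable_mult suminf_mult real_sqrt_mult)

lemma ell2_zero: "(\<lambda>n. 0) \<in> carrier ell2"
  by (simp add: in_carrier_ell2)

lemma abelian_group_ell2: "abelian_group ell2"
proof (rule abelian_groupI)
  show "\<exists>y\<in>carrier ell2. y \<oplus>\<^bsub>ell2\<^esub> x = \<zero>\<^bsub>ell2\<^esub>" if "x \<in> carrier ell2" for x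
    using ell2_smult(1)[OF that, of "-1"] by (intro bexI[of _ "\<lambda>n. - x n"]) auto
qed (auto simp: ell2_add ell2_zero add_ac)

lemma module_ell2: "module complex_line ell2"
  by (rule moduleI)
    (auto simp: cring_complex_line abelian_group_ell2 ell2_smult algebra_simps)

lemma complex_normed_space_ell2: "complex_normed_space ell2"
proof (intro complex_normed_space.intro complex_normed_space_axioms.intro module_ell2)
  fix x assume x: "x \<in> carrier ell2"
  show "0 \<le> vnorm ell2 x"
    using L2_set_le_vnorm[OF x, of 0] by simp
  show "vnorm ell2 x = 0 \<longleftrightarrow> x = \<zero>\<^bsub>ell2\<^esub>"
    using cmod_le_vnorm_ell2[OF x] by (auto simp: fun_eq_iff vnorm_ell2)
  show "vnorm ell2 (a \<odot>\<^bsub>ell2\<^esub> x) = cmod a * vnorm ell2 x" for a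
    using ell2_smult[OF x] by simp
  show "vnorm ell2 (x \<oplus>\<^bsub>ell2\<^esub> y) \<le> vnorm ell2 x + vnorm ell2 y" if "y \<in> carrier ell2" for y
    using ell2_add[OF x that] by simp
qed

interpretation ell2: complex_normed_space ell2
  by (rule complex_normed_space_ell2)

lemma ell2_minus: "x \<in> carrier ell2 \<Longrightarrow> y \<in> carrier ell2 \<Longrightarrow> x \<ominus>\<^bsub>ell2\<^esub> y = (\<lambda>n. x n - y n)"
  using ell2.smult_minus_one[of y] by (simp add: a_minus_def flip: ell2.smult_minus_one)

lemma ell2_finsum:
  assumes "finite A" "\<And>k. k \<in> A \<Longrightarrow> f k \<in> carrier ell2"
  shows "(\<Oplus>\<^bsub>ell2\<^esub>k\<in>A. f k) = (\<lambda>n. \<Sum>k\<in>A. f k n)"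
  using assms by (induction A rule: finite_induct) auto

lemma norm_dist_ell2:
  assumes "x \<in> carrier ell2" "y \<in> carrier ell2"
  shows "norm_dist ell2 x y = vnorm ell2 (\<lambda>n. x n - y n)"
  using assms by (simp add: norm_dist_def ell2_minus)

lemma L2_set_diff_le_norm_dist:
  assumes "x \<in> carrier ell2" "y \<in> carrier ell2"
  shows "L2_set (\<lambda>n. cmod (x n - y n)) {..<M} \<le> norm_dist ell2 x y"
  using L2_set_le_vnorm[of "\<lambda>n. x n - y n" M] ell2.M.minus_closed[OF assms] assms
  by (simp add: norm_dist_ell2 ell2_minus)

lemma mcomplete_ell2: "ell2.norm_metric.mcomplete"
  unfolding ell2.norm_metric.mcomplete_def
proof (intro allI impI)
  fix \<sigma> :: "nat \<Rightarrow> nat \<Rightarrow> complex"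
  assume cau: "ell2.norm_metric.MCauchy \<sigma>"
  then have car: "\<sigma> k \<in> carrier ell2" for k
    unfolding ell2.norm_metric.MCauchy_def by auto
  have cau': "\<exists>K. \<forall>k\<ge>K. \<forall>l\<ge>K. norm_dist ell2 (\<sigma> k) (\<sigma> l) < e" if "e > 0" for e
    using cau that unfolding ell2.norm_metric.MCauchy_def by meson
  have "Cauchy (\<lambda>k. \<sigma> k n)" for n
  proof (rule CauchyI)
    fix e :: real assume "e > 0"
    then obtain K where K: "\<And>k l. k \<ge> K \<Longrightarrow> l \<ge> K \<Longrightarrow> norm_dist ell2 (\<sigma> k) (\<sigma> l) < e"
      using cau' by blast
    have "cmod (\<sigma> k n - \<sigma> l n) \<le> norm_dist ell2 (\<sigma> k) (\<sigma> l)" for k l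
      using L2_set_diff_le_norm_dist[OF car car, of k l "Suc n"]
        member_le_L2_set[of "{..<Suc n}" n "\<lambda>n. cmod (\<sigma> k n - \<sigma> l n)"] by simp
    with K show "\<exists>K. \<forall>k\<ge>K. \<forall>l\<ge>K. cmod (\<sigma> k n - \<sigma> l n) < e"
      by (meson order.strict_trans1)
  qed
  then have x: "(\<lambda>k. \<sigma> k n) \<longlonglongrightarrow> lim (\<lambda>k. \<sigma> k n)" for n
    by (intro convergent_LIMSEQ_iff[THEN iffD1] Cauchy_convergent)
  define x where "x = (\<lambda>n. lim (\<lambda>k. \<sigma> k n))"
  have x: "(\<lambda>k. \<sigma> k n) \<longlonglongrightarrow> x n" for n
    unfolding x_def by (rule x)
  \<comment> \<open>the pointwise limit is a limit in norm: let \<open>l\<close> tend to infinity on each initial segment\<close>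
  have near: "\<exists>K. \<forall>k\<ge>K. \<forall>M. L2_set (\<lambda>n. cmod (x n - \<sigma> k n)) {..<M} \<le> e" if "e > 0" for e
  proof -
    obtain K where K: "\<And>k l. k \<ge> K \<Longrightarrow> l \<ge> K \<Longrightarrow> norm_dist ell2 (\<sigma> k) (\<sigma> l) < e"
      using cau'[OF \<open>e > 0\<close>] by blast
    have "L2_set (\<lambda>n. cmod (x n - \<sigma> k n)) {..<M} \<le> e" if "k \<ge> K" for k M
    proof (rule LIMSEQ_le_const2)
      show "(\<lambda>l. L2_set (\<lambda>n. cmod (\<sigma> l n - \<sigma> k n)) {..<M})
          \<longlonglongrightarrow> L2_set (\<lambda>n. cmod (x n - \<sigma> k n)) {..<M}"
        unfolding L2_set_def by (intro tendsto_intros x)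
      have "L2_set (\<lambda>n. cmod (\<sigma> l n - \<sigma> k n)) {..<M} \<le> e" if "l \<ge> K" for l
        using L2_set_diff_le_norm_dist[OF car car, of l k M] K[OF that \<open>k \<ge> K\<close>] by linarith
      then show "\<exists>N. \<forall>l\<ge>N. L2_set (\<lambda>n. cmod (\<sigma> l n - \<sigma> k n)) {..<M} \<le> e" by blast
    qed
    then show ?thesis by blast
  qed
  obtain k where "\<forall>M. L2_set (\<lambda>n. cmod (x n - \<sigma> k n)) {..<M} \<le> 1"
    using near[of 1] by auto
  then have "(\<lambda>n. x n - \<sigma> k n) \<in> carrier ell2"
    by (intro vnorm_ell2_le(1)[where B = 1]) simp
  from ell2_add(1)[OF this car[of k]] have xc: "x \<in> carrier ell2" by simp
  have "\<exists>K. \<forall>k\<ge>K. norm_dist ell2 (\<sigma> k) x < e" if "e > 0" for e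
  proof -
    obtain K where "\<And>k M. k \<ge> K \<Longrightarrow> L2_set (\<lambda>n. cmod (x n - \<sigma> k n)) {..<M} \<le> e / 2"
      using near[OF half_gt_zero[OF \<open>e > 0\<close>]] by blast
    then have "norm_dist ell2 x (\<sigma> k) \<le> e / 2" if "k \<ge> K" for k
      unfolding norm_dist_ell2[OF xc car] using that by (intro vnorm_ell2_le(2)) blast
    then show ?thesis
      using \<open>e > 0\<close> ell2.norm_metric.commute by (metis field_sum_of_halves less_add_same_cancel1
          half_gt_zero order.strict_trans1)
  qed
  then show "\<exists>x. limitin ell2.norm_metric.mtopology \<sigma> x sequentially"
    using xc car by (auto simp: ell2.norm_metric.limit_metric_sequentially)
qed

lemma ell2_inner_summable:
  assumes "x \<in> carrier ell2" "y \<in> carrier ell2"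
  shows "summable (\<lambda>n. x n * cnj (y n))"
proof (rule summable_comparison_test')
  show "summable (\<lambda>n. (cmod (x n))\<^sup>2 + (cmod (y n))\<^sup>2)"
    using assms unfolding in_carrier_ell2 by (rule summable_add)
  show "norm (x n * cnj (y n)) \<le> (cmod (x n))\<^sup>2 + (cmod (y n))\<^sup>2" if "n \<ge> 0" for n
  proof -
    have "2 * (cmod (x n) * cmod (y n)) \<le> (cmod (x n))\<^sup>2 + (cmod (y n))\<^sup>2"
      using sum_squares_bound[of "cmod (x n)" "cmod (y n)"] by simp
    moreover have "0 \<le> cmod (x n) * cmod (y n)" by simp
    ultimately show ?thesis unfolding norm_mult complex_mod_cnj by linarith
  qed
qed

lemma complex_hilbert_space_ell2: "complex_hilbert_space ell2"
proof (intro complex_hilbert_space.intro complex_hilbert_space_axioms.intro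
    complex_banach_space.intro complex_banach_space_axioms.intro
    complex_normed_space_ell2 mcomplete_ell2)
  fix x y assume xy: "x \<in> carrier ell2" "y \<in> carrier ell2"
  show "cinner ell2 (x \<oplus>\<^bsub>ell2\<^esub> y) z = cinner ell2 x z + cinner ell2 y z"
    if "z \<in> carrier ell2" for z
    using suminf_add[OF ell2_inner_summable[OF xy(1) that] ell2_inner_summable[OF xy(2) that]]
    by (simp add: cinner_ell2 distrib_right)
  show "cinner ell2 (a \<odot>\<^bsub>ell2\<^esub> x) y = a * cinner ell2 x y" for a
    using suminf_mult[OF ell2_inner_summable[OF xy], of a] by (simp add: cinner_ell2 mult.assoc)
  have "(\<lambda>n. cnj (y n * cnj (x n))) sums cnj (cinner ell2 y x)"
    unfolding cinner_ell2 sums_cnj by (intro summable_sums ell2_inner_summable xy)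
  then show "cinner ell2 x y = cnj (cinner ell2 y x)"
    by (simp add: cinner_ell2 sums_iff mult.commute)
next
  fix x assume x: "x \<in> carrier ell2"
  have "(\<lambda>n. complex_of_real ((cmod (x n))\<^sup>2)) sums (\<Sum>n. (cmod (x n))\<^sup>2)"
    using x unfolding in_carrier_ell2 sums_of_real_iff by (rule summable_sums)
  then show "vnorm ell2 x = sqrt (Re (cinner ell2 x x))"
    by (simp add: vnorm_ell2 cinner_ell2 sums_iff complex_norm_square flip: of_real_power)
qed

lemma separable_ell2: "separable_normed_space ell2"
proof -
  obtain D :: "complex set" where D: "countable D" "\<And>X. open X \<Longrightarrow> X \<noteq> {} \<Longrightarrow> \<exists>d\<in>D. d \<in> X"
    by (rule countable_dense_setE) blast
  \<comment> \<open>finitely supported sequences with values in \<open>D\<close> before the end of the list\<close>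
  define S where "S = (\<lambda>l n. if n < length l then l ! n else 0) ` lists D"
  have "countable S"
    unfolding S_def by (intro countable_image countable_lists D)
  moreover have S: "S \<subseteq> carrier ell2"
  proof
    fix x assume "x \<in> S"
    then obtain l where "x = (\<lambda>n. if n < length l then l ! n else 0)"
      by (auto simp: S_def)
    then show "x \<in> carrier ell2"
      unfolding in_carrier_ell2 by (intro summable_finite[of "{..<length l}"]) auto
  qed
  moreover have "x \<in> ell2.norm_metric.mtopology closure_of S" if x: "x \<in> carrier ell2" for x
    unfolding ell2.norm_metric.metric_closure_of mem_Collect_eq
  proof (intro conjI allI impI x)
    fix r :: real assume r: "r > 0"
    have "summable (\<lambda>n. (cmod (x n))\<^sup>2)" using x by (simp add: in_carrier_ell2)
    from suminf_exist_split[OF _ this, of "(r / 3)\<^sup>2"] r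
    obtain N where N: "norm (\<Sum>i. (cmod (x (i + N)))\<^sup>2) < (r / 3)\<^sup>2" by auto
    define e where "e = r / (3 * (real N + 1))"
    have e: "e > 0" using r by (simp add: e_def)
    have "\<exists>d\<in>D. dist d (x n) < e" for n
      using D(2)[of "ball (x n) e"] e by (auto simp: dist_commute)
    then obtain d where d: "\<And>n. d n \<in> D" "\<And>n. dist (d n) (x n) < e" by metis
    define y where "y = (\<lambda>n. if n < N then d n else 0)"
    have "y = (\<lambda>n. if n < length (map d [0..<N]) then map d [0..<N] ! n else 0)"
      by (auto simp: y_def fun_eq_iff)
    then have yS: "y \<in> S"
      unfolding S_def using d(1) by (intro image_eqI[of _ _ "map d [0..<N]"]) auto
    then have yc: "y \<in> carrier ell2" using S by blast
    have "L2_set (\<lambda>n. cmod (x n - y n)) {..<M} \<le> 2 * r / 3" for M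
    proof -
      define f g :: "nat \<Rightarrow> real" where "f = (\<lambda>n. if n < N then cmod (x n - d n) else 0)"
        and "g = (\<lambda>n. if n < N then 0 else cmod (x n))"
      have "L2_set (\<lambda>n. cmod (x n - y n)) {..<M} = L2_set (\<lambda>n. f n + g n) {..<M}"
        by (intro L2_set_cong) (auto simp: f_def g_def y_def)
      also have "\<dots> \<le> L2_set f {..<M} + L2_set g {..<M}"
        by (rule L2_set_triangle_ineq)
      also have "L2_set f {..<M} \<le> r / 3"
      proof -
        have "L2_set f {..<M} \<le> (\<Sum>n<M. f n)"
          by (intro L2_set_le_sum) (simp add: f_def)
        also have "\<dots> \<le> (\<Sum>n<M. if n < N then e else 0)"
          using d(2) by (intro sum_mono) (auto simp: f_def dist_norm norm_minus_commute less_imp_le)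
        also have "\<dots> \<le> real N * e"
        proof -
          have "(\<Sum>n<M. if n < N then e else 0) = (\<Sum>n\<in>{..<M} \<inter> {..<N}. e)"
            by (simp add: sum.inter_restrict del: sum_constant)
          also have "\<dots> \<le> (\<Sum>n<N. e)"
            using e by (intro sum_mono2) auto
          finally show ?thesis by simp
        qed
        also have "\<dots> \<le> r / 3"
          using r by (simp add: e_def field_simps)
        finally show ?thesis .
      qed
      also have "L2_set g {..<M} \<le> r / 3"
      proof -
        have "(\<Sum>n<M. (g n)\<^sup>2) \<le> (\<Sum>n<N + M. (g n)\<^sup>2)"
          by (intro sum_mono2) auto
        also have "\<dots> = (\<Sum>i<M. (g (i + N))\<^sup>2)"
          by (induction M) (simp_all add: g_def add.commute)
        also have "\<dots> = (\<Sum>i<M. (cmod (x (i + N)))\<^sup>2)"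
          by (simp add: g_def)
        also have "\<dots> \<le> (\<Sum>i. (cmod (x (i + N)))\<^sup>2)"
          using x summable_iff_shift[of "\<lambda>n. (cmod (x n))\<^sup>2" N]
          by (intro sum_le_suminf) (auto simp: in_carrier_ell2)
        also have "\<dots> \<le> (r / 3)\<^sup>2"
          using N by (simp add: abs_le_iff)
        finally show ?thesis
          using r unfolding L2_set_def by (intro real_le_lsqrt) auto
      qed
      finally show ?thesis by simp
    qed
    then have "norm_dist ell2 x y \<le> 2 * r / 3"
      unfolding norm_dist_ell2[OF x yc] by (rule vnorm_ell2_le)
    then show "\<exists>y\<in>S. y \<in> ell2.norm_metric.mball x r"
      using r x yc by (intro bexI[OF _ yS]) (auto simp: ell2.norm_metric.in_mball)
  qed
  ultimately show ?thesis
    unfolding separable_normed_space_def separable_space_def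
    using closure_of_subset_topspace[of ell2.norm_metric.mtopology S]
    by (intro exI[of _ S]) auto
qed

section \<open>The operator and its powers\<close>

text \<open>Write \<open>e\<^sub>j\<close> for the unit vector at \<open>2 * j\<close> and \<open>f\<^sub>i\<close> for the one at \<open>2 * i + 1\<close>.  The operator
  moves \<open>e\<^sub>j\<close> up to \<open>e\<^sub>j\<^sub>+\<^sub>1\<close> with factor \<open>weight (j + 1) / weight j\<close>, moves \<open>f\<^sub>i\<^sub>+\<^sub>1\<close> down to \<open>f\<^sub>i\<close> with
  factor \<open>weight (i + 1) / weight i\<close>, annihilates \<open>f\<^sub>0\<close>, and feeds \<open>e\<^sub>i\<close> into \<open>f\<^sub>i\<close> with a
  Rudin--Shapiro sign.\<close>

definition coupled_shift :: "(nat \<Rightarrow> complex) \<Rightarrow> nat \<Rightarrow> complex" where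
  "coupled_shift x m =
    (let i = m div 2 in
      if even m then (if i = 0 then 0 else of_real (weight i / weight (i - 1)) * x (m - 2))
      else of_real (weight (Suc i) / weight i) * x (m + 2)
        + rudin_shapiro i * of_real (amp i / (weight i)\<^sup>2) * x (m - 1))"

lemma coupled_shift_simps:
  "coupled_shift x 0 = 0"
  "coupled_shift x (2 * Suc j) = of_real (weight (Suc j) / weight j) * x (2 * j)"
  "coupled_shift x (Suc (2 * i)) = of_real (weight (Suc i) / weight i) * x (Suc (2 * Suc i))
     + rudin_shapiro i * of_real (amp i / (weight i)\<^sup>2) * x (2 * i)"
  by (simp_all add: coupled_shift_def Let_def)

text \<open>The coefficient of index \<open>j\<close> on the chain of the \<open>e\<^sub>j\<close> after \<open>k\<close> steps, divided by \<open>weight j\<close>: in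
  this normalization the operator is the plain shift on that chain.\<close>

definition advance :: "(nat \<Rightarrow> complex) \<Rightarrow> nat \<Rightarrow> nat \<Rightarrow> complex" where
  "advance x k j = (if k \<le> j then x (2 * (j - k)) / of_real (weight (j - k)) else 0)"

lemma advance_Suc_Suc [simp]: "advance x (Suc k) (Suc j) = advance x k j"
  by (simp add: advance_def)

lemma coupled_shift_power_even:
  "(coupled_shift ^^ k) x (2 * j) = of_real (weight j) * advance x k j"
proof (induction k arbitrary: j)
  case 0
  show ?case using weight_pos[of j] by (simp add: advance_def less_imp_neq[symmetric])
next
  case (Suc k)
  show ?case
  proof (cases j)
    case 0
    then show ?thesis by (simp add: coupled_shift_simps advance_def)
  next
    case (Suc i)
    have "(coupled_shift ^^ Suc k) x (2 * Suc i)
        = of_real (weight (Suc i) / weight i) * (of_real (weight i) * advance x k i)"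
      by (simp only: funpow.simps comp_apply coupled_shift_simps Suc.IH)
    also have "\<dots> = of_real (weight (Suc i)) * advance x (Suc k) (Suc i)"
      using weight_pos[of i] by (simp add: advance_def less_imp_neq[symmetric])
    finally show ?thesis using Suc by simp
  qed
qed

text \<open>In the sum, \<open>l\<close> is the number of steps made on the descending chain, so that the crossing takes
  place at \<open>p = i + l\<close>, after \<open>k - 1 - l\<close> steps on the ascending one.\<close>

lemma coupled_shift_power_odd:
  "of_real (weight i) * (coupled_shift ^^ k) x (Suc (2 * i))
    = of_real (weight (i + k)) * x (Suc (2 * (i + k)))
      + (\<Sum>l<k. rudin_shapiro (i + l) * of_real (amp (i + l)) * advance x k (i + 2 * l + 1))"
proof (induction k arbitrary: i)
  case (Suc k)
  have w: "weight i \<noteq> 0" using weight_pos[of i] by linarith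
  have "of_real (weight i) * (coupled_shift ^^ Suc k) x (Suc (2 * i))
      = of_real (weight (Suc i)) * (coupled_shift ^^ k) x (Suc (2 * Suc i))
        + rudin_shapiro i * of_real (amp i) * advance x k i"
    using w by (simp only: funpow.simps comp_apply coupled_shift_simps coupled_shift_power_even)
      (simp add: field_simps power2_eq_square)
  also have "\<dots> = of_real (weight (Suc i + k)) * x (Suc (2 * (Suc i + k)))
      + ((\<Sum>l<k. rudin_shapiro (Suc i + l) * of_real (amp (Suc i + l))
          * advance x k (Suc i + 2 * l + 1))
        + rudin_shapiro i * of_real (amp i) * advance x k i)"
    unfolding Suc.IH by simp
  also have "(\<Sum>l<k. rudin_shapiro (Suc i + l) * of_real (amp (Suc i + l))
          * advance x k (Suc i + 2 * l + 1)) + rudin_shapiro i * of_real (amp i) * advance x k i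
      = (\<Sum>l<Suc k. rudin_shapiro (i + l) * of_real (amp (i + l))
          * advance x (Suc k) (i + 2 * l + 1))"
    by (simp only: sum.lessThan_Suc_shift) simp
  finally show ?case by simp
qed simp

section \<open>Bounds for sums of powers\<close>

lemma band_kernel_sum_reindex_le:
  assumes "finite K" "inj_on \<phi> K" "\<phi> ` K \<subseteq> {..<i + n}" "\<And>j. 0 \<le> a j"
  shows "(\<Sum>k\<in>K. band_kernel n i (\<phi> k) * a (\<phi> k)) \<le> (\<Sum>j<i + n. band_kernel n i j * a j)"
proof -
  have "(\<Sum>k\<in>K. band_kernel n i (\<phi> k) * a (\<phi> k)) = (\<Sum>j\<in>\<phi> ` K. band_kernel n i j * a j)"
    using assms(2) by (simp add: sum.reindex)
  also have "\<dots> \<le> (\<Sum>j<i + n. band_kernel n i j * a j)"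
    using assms by (intro sum_mono2) (auto intro!: mult_nonneg_nonneg band_kernel_nonneg)
  finally show ?thesis .
qed

lemma power_sum_even_le:
  assumes "cmod \<mu> = 1"
  shows "cmod (\<Sum>k<n. \<mu> ^ k * (coupled_shift ^^ k) x (2 * i))
    \<le> (\<Sum>j<i + n. band_kernel n i j * cmod (x (2 * j)))"
proof -
  have "cmod (\<Sum>k<n. \<mu> ^ k * (coupled_shift ^^ k) x (2 * i))
      \<le> (\<Sum>k<n. if k \<le> i then band_kernel n i (i - k) * cmod (x (2 * (i - k))) else 0)"
  proof (rule sum_norm_le)
    fix k assume k: "k \<in> {..<n}"
    have "weight i / weight (i - k) * cmod (x (2 * (i - k)))
        \<le> band_kernel n i (i - k) * cmod (x (2 * (i - k)))" if "k \<le> i"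
      using k that by (intro mult_right_mono band_kernel_ge_ratio) auto
    then show "cmod (\<mu> ^ k * (coupled_shift ^^ k) x (2 * i))
        \<le> (if k \<le> i then band_kernel n i (i - k) * cmod (x (2 * (i - k))) else 0)"
      using assms
      by (simp add: coupled_shift_power_even advance_def norm_mult norm_divide norm_power)
  qed
  also have "\<dots> = (\<Sum>k\<in>{..<n} \<inter> {..i}. band_kernel n i (i - k) * cmod (x (2 * (i - k))))"
    by (simp add: sum.inter_restrict)
  also have "\<dots> \<le> (\<Sum>j<i + n. band_kernel n i j * cmod (x (2 * j)))"
    by (rule band_kernel_sum_reindex_le) (auto simp: inj_on_def)
  finally show ?thesis .
qed

text \<open>The entry of \<open>\<Sum>k<n. \<mu>\<^sup>k T\<^sup>k\<close> that leads from \<open>e\<^sub>j\<close> to \<open>f\<^sub>i\<close>, up to the factor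
  \<open>1 / (weight i * weight j)\<close>.  The place \<open>p\<close> of the crossing determines the time
  \<open>k = 2 * p + 1 - i - j\<close> and runs through an interval, so the entry is a Rudin--Shapiro sum at the
  point \<open>\<mu>\<^sup>2\<close>.\<close>

lemma corner_coefficient_le:
  assumes \<mu>: "cmod \<mu> = 1"
  shows "cmod (\<Sum>k<n. \<Sum>l<k. if j + k = i + 2 * l + 1
      then \<mu> ^ k * (rudin_shapiro (i + l) * of_real (amp (i + l))) else 0)
    \<le> 20 * (weight i * weight j * band_kernel n i j)"
    (is "cmod ?c \<le> _")
proof -
  define \<psi> :: "nat \<Rightarrow> complex" where "\<psi> = (\<lambda>p. rudin_shapiro p * of_real (amp p))"
  define a b where "a = max i j" and "b = (n + i + j) div 2"
  define Q where "Q = {(k, l). l < k \<and> k < n \<and> j + k = i + 2 * l + 1}"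
  have "?c = (\<Sum>(k, l)\<in>(SIGMA k:{..<n}. {..<k}). if j + k = i + 2 * l + 1 then \<mu> ^ k * \<psi> (i + l) else 0)"
    unfolding \<psi>_def by (subst sum.Sigma) auto
  also have "\<dots> = (\<Sum>(k, l)\<in>Q. \<mu> ^ k * \<psi> (i + l))"
    by (rule sum.mono_neutral_cong_right) (auto simp: Q_def split: if_splits)
  also have "\<dots> = (\<Sum>p\<in>{a..<b}. \<mu> ^ (2 * p + 1 - i - j) * \<psi> p)"
  proof (rule sum.reindex_bij_witness[of _ "\<lambda>p. (2 * p + 1 - i - j, p - i)" "\<lambda>(k, l). i + l"])
    fix q assume "q \<in> Q"
    then obtain k l where q: "q = (k, l)" "j + k = i + 2 * l + 1" by (auto simp: Q_def)
    then have "2 * (i + l) + 1 - i - j = k" by simp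
    then show "\<mu> ^ (2 * (case q of (k, l) \<Rightarrow> i + l) + 1 - i - j) * \<psi> (case q of (k, l) \<Rightarrow> i + l)
        = (case q of (k, l) \<Rightarrow> \<mu> ^ k * \<psi> (i + l))"
      by (simp add: q(1))
  qed (auto simp: Q_def a_def b_def)
  finally have c: "?c = (\<Sum>p\<in>{a..<b}. \<mu> ^ (2 * p + 1 - i - j) * \<psi> p)" .
  \<comment> \<open>a unimodular factor makes the exponent of \<open>\<mu>\<close> independent of \<open>i\<close> and \<open>j\<close>\<close>
  have "\<mu> ^ (i + j) * ?c = (\<Sum>p\<in>{a..<b}. \<mu> * (rudin_shapiro p * (\<mu>\<^sup>2) ^ p * of_real (amp p)))"
    unfolding c sum_distrib_left
  proof (rule sum.cong[OF refl])
    fix p assume "p \<in> {a..<b}"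
    then have "i + j + (2 * p + 1 - i - j) = Suc (2 * p)"
      by (auto simp: a_def)
    then have "\<mu> ^ (i + j) * \<mu> ^ (2 * p + 1 - i - j) = \<mu> * (\<mu>\<^sup>2) ^ p"
      unfolding power_add[symmetric] power_mult[symmetric] by simp
    then show "\<mu> ^ (i + j) * (\<mu> ^ (2 * p + 1 - i - j) * \<psi> p)
        = \<mu> * (rudin_shapiro p * (\<mu>\<^sup>2) ^ p * of_real (amp p))"
      unfolding \<psi>_def mult.assoc[symmetric] by (simp add: mult_ac)
  qed
  then have "cmod (\<mu> ^ (i + j) * ?c)
      = cmod (\<mu> * (\<Sum>p\<in>{a..<b}. rudin_shapiro p * (\<mu>\<^sup>2) ^ p * of_real (amp p)))"
    by (simp only: sum_distrib_left)
  then have nc: "cmod ?c = cmod (\<Sum>p\<in>{a..<b}. rudin_shapiro p * (\<mu>\<^sup>2) ^ p * of_real (amp p))"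
    using \<mu> by (simp only: norm_mult norm_power) simp
  show ?thesis
  proof (cases "a < b")
    case True
    then have band: "i < j + n" "j < i + n" "b \<le> a + n"
      by (auto simp: a_def b_def)
    have "cmod ?c \<le> 20 * (weight b)\<^sup>2"
      unfolding nc using \<mu> True by (intro rs_interval_sum_le) (auto simp: norm_power)
    also have "\<dots> \<le> 20 * (weight (a + n))\<^sup>2"
      using weight_mono[OF band(3)] by (simp add: power_mono)
    also have "(weight (a + n))\<^sup>2 = weight i * weight j * band_kernel n i j"
      using band weight_pos[of i] weight_pos[of j]
      by (simp add: band_kernel_def a_def less_imp_neq[symmetric])
    finally show ?thesis .
  next
    case False
    then have "cmod ?c = 0" unfolding nc by simp
    then show ?thesis by (simp add: band_kernel_nonneg)
  qed
qed

lemma corner_sum_le: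
  assumes \<mu>: "cmod \<mu> = 1"
  shows "cmod (\<Sum>k<n. \<mu> ^ k *
      (\<Sum>l<k. rudin_shapiro (i + l) * of_real (amp (i + l)) * advance x k (i + 2 * l + 1)))
    \<le> weight i * (20 * (\<Sum>j<i + n. band_kernel n i j * cmod (x (2 * j))))"
    (is "cmod ?Z \<le> _")
proof -
  define c where "c j = (\<Sum>k<n. \<Sum>l<k. if j + k = i + 2 * l + 1
      then \<mu> ^ k * (rudin_shapiro (i + l) * of_real (amp (i + l))) else 0)" for j
  have adv: "advance x k (i + 2 * l + 1)
      = (\<Sum>j<i + n. if j + k = i + 2 * l + 1 then x (2 * j) / of_real (weight j) else 0)"
    if "k < n" "l < k" for k l
  proof (cases "k \<le> i + 2 * l + 1")
    case True
    then have "(\<Sum>j<i + n. if j + k = i + 2 * l + 1 then x (2 * j) / of_real (weight j) else 0)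
      = (\<Sum>j<i + n. if j = i + 2 * l + 1 - k then x (2 * j) / of_real (weight j) else 0)"
      by (intro sum.cong) auto
    with True that show ?thesis by (simp add: advance_def)
  next
    case False
    then show ?thesis by (auto simp: advance_def intro!: sum.neutral[symmetric])
  qed
  have "?Z = (\<Sum>k<n. \<Sum>l<k. \<Sum>j<i + n. x (2 * j) / of_real (weight j) *
      (if j + k = i + 2 * l + 1
       then \<mu> ^ k * (rudin_shapiro (i + l) * of_real (amp (i + l))) else 0))"
    unfolding sum_distrib_left
  proof (intro sum.cong refl)
    fix k l assume "k \<in> {..<n}" "l \<in> {..<k}"
    then have kl: "k < n" "l < k" by auto
    show "\<mu> ^ k * (rudin_shapiro (i + l) * of_real (amp (i + l)) * advance x k (i + 2 * l + 1))
      = (\<Sum>j<i + n. x (2 * j) / of_real (weight j) * (if j + k = i + 2 * l + 1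
          then \<mu> ^ k * (rudin_shapiro (i + l) * of_real (amp (i + l))) else 0))"
      unfolding adv[OF kl] sum_distrib_left
      by (intro sum.cong) auto
  qed
  also have "\<dots> = (\<Sum>j<i + n. x (2 * j) / of_real (weight j) * c j)"
    unfolding c_def sum_distrib_left
    by (subst sum.swap[where A = "{..<i + n}"]) (intro sum.cong refl sum.swap)
  finally have "cmod ?Z = cmod (\<Sum>j<i + n. x (2 * j) / of_real (weight j) * c j)" by simp
  also have "\<dots> \<le> (\<Sum>j<i + n. weight i * (20 * (band_kernel n i j * cmod (x (2 * j)))))"
  proof (rule sum_norm_le)
    fix j
    have "cmod (x (2 * j) / of_real (weight j) * c j) = cmod (x (2 * j)) / weight j * cmod (c j)"
      by (simp add: norm_mult norm_divide)
    also have "\<dots> \<le> cmod (x (2 * j)) / weight j * (20 * (weight i * weight j * band_kernel n i j))"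
      unfolding c_def by (intro mult_left_mono corner_coefficient_le \<mu>) simp
    also have "\<dots> = weight i * (20 * (band_kernel n i j * cmod (x (2 * j))))"
      using weight_pos[of j] by (simp add: less_imp_neq[symmetric] mult_ac)
    finally show "cmod (x (2 * j) / of_real (weight j) * c j)
        \<le> weight i * (20 * (band_kernel n i j * cmod (x (2 * j))))" .
  qed
  finally show ?thesis by (simp only: sum_distrib_left)
qed

lemma power_sum_odd_le:
  assumes \<mu>: "cmod \<mu> = 1"
  shows "cmod (\<Sum>k<n. \<mu> ^ k * (coupled_shift ^^ k) x (Suc (2 * i)))
    \<le> (\<Sum>j<i + n. band_kernel n i j * cmod (x (Suc (2 * j))))
      + 20 * (\<Sum>j<i + n. band_kernel n i j * cmod (x (2 * j)))"
    (is "cmod ?S \<le> ?R1 + 20 * ?R2")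
proof -
  define P Z where "P = (\<Sum>k<n. \<mu> ^ k * (of_real (weight (i + k)) * x (Suc (2 * (i + k)))))"
    and "Z = (\<Sum>k<n. \<mu> ^ k *
      (\<Sum>l<k. rudin_shapiro (i + l) * of_real (amp (i + l)) * advance x k (i + 2 * l + 1)))"
  have "of_real (weight i) * ?S
      = (\<Sum>k<n. \<mu> ^ k * (of_real (weight i) * (coupled_shift ^^ k) x (Suc (2 * i))))"
    by (simp add: sum_distrib_left mult_ac)
  also have "\<dots> = P + Z"
    unfolding coupled_shift_power_odd P_def Z_def by (simp only: distrib_left sum.distrib)
  finally have "weight i * cmod ?S = cmod (P + Z)"
    by (metis norm_mult norm_of_real abs_of_nonneg weight_nonneg)
  also have "\<dots> \<le> cmod P + cmod Z" by (rule norm_triangle_ineq)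
  also have "cmod P \<le> weight i * ?R1"
  proof -
    have "cmod P \<le> (\<Sum>k<n. weight i * (band_kernel n i (i + k) * cmod (x (Suc (2 * (i + k))))))"
      unfolding P_def
    proof (rule sum_norm_le)
      fix k assume k: "k \<in> {..<n}"
      have "weight (i + k) / weight i \<le> band_kernel n i (i + k)"
        unfolding band_kernel_commute[of n i] using k by (intro band_kernel_ge_ratio) auto
      then have "weight (i + k) \<le> weight i * band_kernel n i (i + k)"
        using weight_pos[of i] by (simp add: field_simps)
      then have "weight (i + k) * cmod (x (Suc (2 * (i + k))))
          \<le> weight i * band_kernel n i (i + k) * cmod (x (Suc (2 * (i + k))))"
        by (rule mult_right_mono) simp
      then show "cmod (\<mu> ^ k * (of_real (weight (i + k)) * x (Suc (2 * (i + k)))))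
          \<le> weight i * (band_kernel n i (i + k) * cmod (x (Suc (2 * (i + k)))))"
        using \<mu> by (simp add: norm_mult norm_power mult.assoc)
    qed
    also have "\<dots> = weight i * (\<Sum>k<n. band_kernel n i (i + k) * cmod (x (Suc (2 * (i + k)))))"
      by (simp only: sum_distrib_left)
    also have "\<dots> \<le> weight i * ?R1"
      using band_kernel_sum_reindex_le[of "{..<n}" "\<lambda>k. i + k" i n "\<lambda>j. cmod (x (Suc (2 * j)))"]
      by (intro mult_left_mono) (simp_all add: inj_on_def image_subset_iff)
    finally show ?thesis .
  qed
  also have "cmod Z \<le> weight i * (20 * ?R2)"
    unfolding Z_def by (rule corner_sum_le[OF \<mu>])
  finally have "weight i * cmod ?S \<le> weight i * (?R1 + 20 * ?R2)"
    by (simp add: distrib_left)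
  then show ?thesis using weight_pos[of i] by (simp only: mult_le_cancel_left_pos)
qed

lemma sum_parity_split:
  fixes f :: "nat \<Rightarrow> real"
  shows "(\<Sum>m<2 * M. f m) = (\<Sum>i<M. f (2 * i)) + (\<Sum>i<M. f (Suc (2 * i)))"
  by (induction M) auto

lemma L2_set_parity_split:
  fixes f :: "nat \<Rightarrow> real"
  shows "L2_set f {..<2 * M} \<le> L2_set (\<lambda>i. f (2 * i)) {..<M} + L2_set (\<lambda>i. f (Suc (2 * i))) {..<M}"
  unfolding L2_set_def sum_parity_split by (rule sqrt_add_le_add_sqrt) (auto intro: sum_nonneg)

text \<open>The constant is \<open>30 + 30 + 20 * 30\<close>: one kernel for each chain, and \<open>20\<close> for the coupling.\<close>

lemma power_sum_bound:
  assumes \<mu>: "cmod \<mu> = 1" and x: "x \<in> carrier ell2"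
  shows "L2_set (\<lambda>m. cmod (\<Sum>k<n. \<mu> ^ k * (coupled_shift ^^ k) x m)) {..<M}
    \<le> 660 * vnorm ell2 x * n"
proof (cases "n = 0")
  case True
  then show ?thesis by (simp add: L2_set_0')
next
  case False
  then have n: "n \<ge> 1" by simp
  define S where "S m = cmod (\<Sum>k<n. \<mu> ^ k * (coupled_shift ^^ k) x m)" for m
  define a b where "a j = cmod (x (2 * j))" and "b j = cmod (x (Suc (2 * j)))" for j
  define K where "K c i = (\<Sum>j<i + n. band_kernel n i j * c j)" for c i
  have parts: "L2_set a {..<L} \<le> vnorm ell2 x" "L2_set b {..<L} \<le> vnorm ell2 x" for L
  proof -
    have "L2_set (\<lambda>m. cmod (x m)) {..<2 * L} \<le> vnorm ell2 x"
      by (rule L2_set_le_vnorm[OF x])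
    moreover have "L2_set a {..<L} \<le> L2_set (\<lambda>m. cmod (x m)) {..<2 * L}"
      "L2_set b {..<L} \<le> L2_set (\<lambda>m. cmod (x m)) {..<2 * L}"
      unfolding L2_set_def a_def b_def sum_parity_split by (auto intro!: sum_nonneg)
    ultimately show "L2_set a {..<L} \<le> vnorm ell2 x" "L2_set b {..<L} \<le> vnorm ell2 x"
      by linarith+
  qed
  have Ka: "L2_set (K a) {..<M} \<le> 30 * real n * vnorm ell2 x"
    unfolding K_def by (rule band_kernel_bound[OF n parts(1)]) (simp add: a_def)
  have Kb: "L2_set (K b) {..<M} \<le> 30 * real n * vnorm ell2 x"
    unfolding K_def by (rule band_kernel_bound[OF n parts(2)]) (simp add: b_def)
  have "L2_set S {..<M} \<le> L2_set S {..<2 * M}"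
    unfolding L2_set_def by (intro real_sqrt_le_mono sum_mono2) auto
  also have "\<dots> \<le> L2_set (\<lambda>i. S (2 * i)) {..<M} + L2_set (\<lambda>i. S (Suc (2 * i))) {..<M}"
    by (rule L2_set_parity_split)
  also have "L2_set (\<lambda>i. S (2 * i)) {..<M} \<le> L2_set (K a) {..<M}"
    unfolding S_def K_def a_def by (intro L2_set_mono power_sum_even_le \<mu>) simp
  also have "L2_set (\<lambda>i. S (Suc (2 * i))) {..<M} \<le> L2_set (\<lambda>i. K b i + 20 * K a i) {..<M}"
    unfolding S_def K_def a_def b_def by (intro L2_set_mono power_sum_odd_le \<mu>) simp
  also have "\<dots> \<le> L2_set (K b) {..<M} + 20 * L2_set (K a) {..<M}"
    using L2_set_triangle_ineq[of "K b" "\<lambda>i. 20 * K a i"] by (simp add: L2_set_right_distrib)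
  finally show ?thesis using Ka Kb unfolding S_def by (simp add: mult_ac)
qed

text \<open>Summation by parts: decreasing weights on the terms \<open>y k\<close> cost no more than they would if every
  term had norm \<open>C\<close>.\<close>

lemma L2_set_weighted_sum_le:
  fixes y :: "nat \<Rightarrow> nat \<Rightarrow> complex" and c :: "nat \<Rightarrow> real"
  assumes c: "decseq c" "\<And>k. 0 \<le> c k"
    and B: "\<And>N. L2_set (\<lambda>m. cmod (\<Sum>k<N. y k m)) A \<le> C * real N"
  shows "L2_set (\<lambda>m. cmod (\<Sum>k<N. of_real (c k) * y k m)) A \<le> C * (\<Sum>k<N. c k)"
proof -
  define b where "b N m = (\<Sum>k<N. y k m)" for N m
  have parts: "(\<Sum>k<N. of_real (c k) * y k m) = of_real (c N) * b N m
      + (\<Sum>k<N. of_real (c k - c (Suc k)) * b (Suc k) m)" for m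
    by (induction N) (simp_all add: b_def algebra_simps)
  have parts1: "(\<Sum>k<N. c k) = c N * N + (\<Sum>k<N. (c k - c (Suc k)) * Suc k)"
    by (induction N) (simp_all add: algebra_simps)
  have dc: "0 \<le> c k - c (Suc k)" for k using decseq_SucD[OF c(1)] by simp
  have "L2_set (\<lambda>m. cmod (\<Sum>k<N. of_real (c k) * y k m)) A
     \<le> L2_set (\<lambda>m. c N * cmod (b N m) + (\<Sum>k<N. (c k - c (Suc k)) * cmod (b (Suc k) m))) A"
  proof (rule L2_set_mono)
    fix m
    have "cmod (\<Sum>k<N. of_real (c k - c (Suc k)) * b (Suc k) m)
        \<le> (\<Sum>k<N. (c k - c (Suc k)) * cmod (b (Suc k) m))"
      using dc by (intro sum_norm_le) (simp only: norm_mult norm_of_real abs_of_nonneg)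
    moreover have "cmod (of_real (c N) * b N m) = c N * cmod (b N m)"
      using c(2) by (simp add: norm_mult)
    ultimately show "cmod (\<Sum>k<N. of_real (c k) * y k m)
        \<le> c N * cmod (b N m) + (\<Sum>k<N. (c k - c (Suc k)) * cmod (b (Suc k) m))"
      unfolding parts by (intro norm_triangle_le) simp
  qed simp
  also have "\<dots> \<le> L2_set (\<lambda>m. c N * cmod (b N m)) A
      + L2_set (\<lambda>m. \<Sum>k<N. (c k - c (Suc k)) * cmod (b (Suc k) m)) A"
    by (rule L2_set_triangle_ineq)
  also have "\<dots> \<le> L2_set (\<lambda>m. c N * cmod (b N m)) A
      + (\<Sum>k<N. L2_set (\<lambda>m. (c k - c (Suc k)) * cmod (b (Suc k) m)) A)"
    by (intro add_left_mono L2_set_sum_le)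
  also have "\<dots> = c N * L2_set (\<lambda>m. cmod (b N m)) A
      + (\<Sum>k<N. (c k - c (Suc k)) * L2_set (\<lambda>m. cmod (b (Suc k) m)) A)"
    using c(2) dc by (simp add: L2_set_right_distrib)
  also have "\<dots> \<le> c N * (C * N) + (\<Sum>k<N. (c k - c (Suc k)) * (C * Suc k))"
    using B unfolding b_def by (intro add_mono sum_mono mult_left_mono c(2) dc)
  also have "\<dots> = C * (\<Sum>k<N. c k)"
    unfolding parts1 distrib_left sum_distrib_left by (simp add: mult_ac)
  finally show ?thesis .
qed

section \<open>The counterexample\<close>

lemma bounded_operator_coupled_shift: "bounded_operator ell2 ell2 coupled_shift"
proof -
  have le: "L2_set (\<lambda>m. cmod (coupled_shift x m)) {..<M} \<le> 1321 * vnorm ell2 x"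
    if x: "x \<in> carrier ell2" for x M
  proof -
    \<comment> \<open>the operator is the sum of its first two powers minus the identity\<close>
    define S where "S m = cmod (\<Sum>k<2. 1 ^ k * (coupled_shift ^^ k) x m)" for m
    have "cmod (coupled_shift x m) \<le> S m + cmod (x m)" for m
    proof -
      have "coupled_shift x m = (\<Sum>k<2. 1 ^ k * (coupled_shift ^^ k) x m) - x m"
        by (simp add: numeral_2_eq_2)
      then show ?thesis unfolding S_def by (metis norm_triangle_ineq4)
    qed
    then have "L2_set (\<lambda>m. cmod (coupled_shift x m)) {..<M} \<le> L2_set (\<lambda>m. S m + cmod (x m)) {..<M}"
      by (intro L2_set_mono) auto
    also have "\<dots> \<le> L2_set S {..<M} + L2_set (\<lambda>m. cmod (x m)) {..<M}"
      by (rule L2_set_triangle_ineq)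
    also have "\<dots> \<le> 660 * vnorm ell2 x * 2 + vnorm ell2 x"
      using power_sum_bound[of 1 x 2 M] L2_set_le_vnorm[OF x, of M] x unfolding S_def by simp
    finally show ?thesis by simp
  qed
  have "linear_operator ell2 ell2 coupled_shift"
    unfolding linear_operator_def
  proof (intro conjI ballI allI)
    show "coupled_shift \<in> carrier ell2 \<rightarrow> carrier ell2"
      using vnorm_ell2_le(1)[OF le] by blast
    show "coupled_shift (x \<oplus>\<^bsub>ell2\<^esub> y) = coupled_shift x \<oplus>\<^bsub>ell2\<^esub> coupled_shift y" for x y
      by (auto simp: fun_eq_iff coupled_shift_def Let_def distrib_left)
    show "coupled_shift (a \<odot>\<^bsub>ell2\<^esub> x) = a \<odot>\<^bsub>ell2\<^esub> coupled_shift x" for a x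
      by (auto simp: fun_eq_iff coupled_shift_def Let_def algebra_simps)
  qed
  then show ?thesis
    unfolding bounded_operator_def using vnorm_ell2_le(2)[OF le] by blast
qed

lemma coupled_shift_power_carrier:
  "x \<in> carrier ell2 \<Longrightarrow> (coupled_shift ^^ k) x \<in> carrier ell2"
  using bounded_operator_coupled_shift
  by (induction k) (auto simp: bounded_operator_def linear_operator_def)

lemma operator_norm_le:
  assumes "complex_normed_space X" "\<And>x. x \<in> carrier X \<Longrightarrow> vnorm X x \<le> 1 \<Longrightarrow> vnorm Y (S x) \<le> B"
  shows "operator_norm X Y S \<le> B"
proof -
  interpret complex_normed_space X by fact
  have "\<zero>\<^bsub>X\<^esub> \<in> {x \<in> carrier X. vnorm X x \<le> 1}"
    using vnorm_eq_0_iff[of "\<zero>\<^bsub>X\<^esub>"] by simp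
  then show ?thesis
    unfolding operator_norm_def using assms(2) by (intro cSUP_least) auto
qed

lemma uniformly_kreiss_bounded_coupled_shift: "uniformly_kreiss_bounded ell2 coupled_shift"
  unfolding uniformly_kreiss_bounded_def
proof (intro exI[of _ 660] conjI allI impI operator_norm_le[OF complex_normed_space_ell2])
  fix n and l :: complex and x
  assume l: "cmod l > 1" and x: "x \<in> carrier ell2" "vnorm ell2 x \<le> 1"
  \<comment> \<open>polar decomposition of \<open>1 / l\<close>\<close>
  define r where "r = 1 / cmod l"
  define \<mu> where "\<mu> = of_real (cmod l) / l"
  have "0 < cmod l" using l by linarith
  then have l0: "l \<noteq> 0" by simp
  have r: "0 < r" "r < 1" using l l0 by (simp_all add: r_def)
  have \<mu>: "cmod \<mu> = 1" using l0 by (simp add: \<mu>_def norm_divide)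
  have inv: "inverse l = of_real r * \<mu>" using l0 by (simp add: r_def \<mu>_def field_simps)
  have pw: "l powi (- int k - 1) = of_real (r ^ Suc k) * (\<mu> * \<mu> ^ k)" for k
  proof -
    have "l powi (- int k - 1) = inverse l ^ Suc k"
      using l0 by (simp add: power_int_def nat_add_distrib)
    then show ?thesis unfolding inv by (simp add: power_mult_distrib)
  qed
  have "(\<Oplus>\<^bsub>ell2\<^esub>k\<in>{0..n}. l powi (- int k - 1) \<odot>\<^bsub>ell2\<^esub> (coupled_shift ^^ k) x)
      = (\<lambda>m. \<Sum>k\<in>{0..n}. l powi (- int k - 1) * (coupled_shift ^^ k) x m)"
    using x by (subst ell2_finsum) (auto intro: ell2_smult coupled_shift_power_carrier)
  also have "\<dots> = (\<lambda>m. \<Sum>k<Suc n. of_real (r ^ Suc k) * (\<mu> * (\<mu> ^ k * (coupled_shift ^^ k) x m)))"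
    by (simp only: pw atLeast0AtMost lessThan_Suc_atMost mult.assoc)
  finally have eq: "(\<Oplus>\<^bsub>ell2\<^esub>k\<in>{0..n}. l powi (- int k - 1) \<odot>\<^bsub>ell2\<^esub> (coupled_shift ^^ k) x)
      = (\<lambda>m. \<Sum>k<Suc n. of_real (r ^ Suc k) * (\<mu> * (\<mu> ^ k * (coupled_shift ^^ k) x m)))" .
  have "L2_set (\<lambda>m. cmod (\<Sum>k<Suc n. of_real (r ^ Suc k)
      * (\<mu> * (\<mu> ^ k * (coupled_shift ^^ k) x m)))) {..<M} \<le> 660 * (\<Sum>k<Suc n. r ^ Suc k)" for M
  proof (rule L2_set_weighted_sum_le)
    show "decseq (\<lambda>k. r ^ Suc k)"
      using r by (intro decseq_SucI power_decreasing) auto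
    show "0 \<le> r ^ Suc k" for k using r by simp
    have "L2_set (\<lambda>m. cmod (\<Sum>k<N. \<mu> ^ k * (coupled_shift ^^ k) x m)) {..<M} \<le> 660 * real N" for N
    proof -
      have "660 * vnorm ell2 x * N \<le> 660 * 1 * real N"
        using x(2) by (intro mult_right_mono mult_left_mono) auto
      with power_sum_bound[OF \<mu> x(1), of N M] show ?thesis by linarith
    qed
    then show "L2_set (\<lambda>m. cmod (\<Sum>k<N. \<mu> * (\<mu> ^ k * (coupled_shift ^^ k) x m))) {..<M} \<le> 660 * real N" for N
      using \<mu> by (simp add: norm_mult flip: sum_distrib_left)
  qed
  also have "660 * (\<Sum>k<Suc n. r ^ Suc k) \<le> 660 / (cmod l - 1)"
  proof -
    have "(1 - r) * (\<Sum>k<Suc n. r ^ Suc k) = r * (1 - r ^ Suc n)"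
      unfolding one_diff_power_eq by (simp only: power_Suc sum_distrib_left mult_ac)
    also have "\<dots> \<le> r * 1" using r by (intro mult_left_mono) auto
    finally have "(\<Sum>k<Suc n. r ^ Suc k) \<le> r / (1 - r)"
      using r by (simp add: pos_le_divide_eq mult.commute)
    also have "\<dots> = 1 / (cmod l - 1)" using l l0 by (simp add: r_def field_simps)
    finally show ?thesis by simp
  qed
  finally show "vnorm ell2 (\<Oplus>\<^bsub>ell2\<^esub>k\<in>{0..n}. l powi (- int k - 1) \<odot>\<^bsub>ell2\<^esub> (coupled_shift ^^ k) x)
      \<le> 660 / (cmod l - 1)"
    unfolding eq by (rule vnorm_ell2_le)
qed simp

text \<open>The vector \<open>e\<^sub>0\<close> and the coordinate functional of \<open>f\<^sub>0\<close> see the amplitude \<open>amp p\<close> at time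
  \<open>2 * p + 1\<close>.\<close>

lemma not_strongly_cesaro_bounded_coupled_shift: "\<not> strongly_cesaro_bounded ell2 coupled_shift"
proof
  assume "strongly_cesaro_bounded ell2 coupled_shift"
  then obtain C where C: "C > 0" "\<And>x f N. x \<in> carrier ell2 \<Longrightarrow> f \<in> dual_space ell2 \<Longrightarrow> N \<ge> 1 \<Longrightarrow>
      (1 / real N) * (\<Sum>k=0..N-1. cmod (f ((coupled_shift ^^ k) x))) \<le> C * vnorm ell2 x * dual_norm ell2 f"
    unfolding strongly_cesaro_bounded_def by blast
  define e :: "nat \<Rightarrow> complex" where "e = (\<lambda>m. if m = 0 then 1 else 0)"
  define f :: "(nat \<Rightarrow> complex) \<Rightarrow> complex" where "f = (\<lambda>x. x 1)"
  have "(\<lambda>m. (cmod (e m))\<^sup>2) = (\<lambda>m. if m = 0 then 1 else 0)"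
    by (auto simp: e_def)
  then have "(\<lambda>m. (cmod (e m))\<^sup>2) sums 1"
    using sums_single[of 0 "\<lambda>_. 1::real"] by simp
  then have e: "e \<in> carrier ell2" "vnorm ell2 e = 1"
    by (auto simp: in_carrier_ell2 vnorm_ell2 sums_iff)
  have fb: "vnorm complex_line (f x) \<le> 1 * vnorm ell2 x" if "x \<in> carrier ell2" for x
    using cmod_le_vnorm_ell2[OF that, of 1] by (simp add: f_def)
  have f: "f \<in> dual_space ell2"
    unfolding dual_space_def bounded_operator_def linear_operator_def
    using fb by (auto simp: f_def intro!: exI[of _ 1])
  have df: "dual_norm ell2 f \<le> 1"
    unfolding dual_norm_def using fb by (intro operator_norm_le complex_normed_space_ell2) force
  have val: "cmod (f ((coupled_shift ^^ (2 * p + 1)) e)) = amp p" for p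
  proof -
    have adv: "advance e (2 * p + 1) (2 * l + 1) = (if l = p then 1 else 0)" for l
      by (auto simp: advance_def e_def)
    have "f ((coupled_shift ^^ (2 * p + 1)) e)
        = (\<Sum>l<2 * p + 1. rudin_shapiro l * of_real (amp l) * advance e (2 * p + 1) (2 * l + 1))"
      using coupled_shift_power_odd[of 0 "2 * p + 1" e] by (simp add: f_def e_def)
    also have "\<dots> = (\<Sum>l<2 * p + 1. if l = p then rudin_shapiro l * of_real (amp l) else 0)"
      unfolding adv by (intro sum.cong) auto
    also have "\<dots> = rudin_shapiro p * of_real (amp p)"
      by simp
    finally show ?thesis by (simp add: norm_mult)
  qed
  have bound: "amp M \<le> 4 * C" if "M \<ge> 1" for M
  proof -
    \<comment> \<open>the odd times \<open>2 * p + 1\<close> with \<open>M \<le> p < 2 * M\<close> lie below \<open>4 * M\<close>\<close>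
    have "real M * amp M = (\<Sum>p\<in>{M..<2 * M}. amp M)" by simp
    also have "\<dots> \<le> (\<Sum>p\<in>{M..<2 * M}. amp p)"
      by (intro sum_mono monoD[OF amp_mono]) simp
    also have "\<dots> = (\<Sum>p\<in>{M..<2 * M}. cmod (f ((coupled_shift ^^ (2 * p + 1)) e)))"
      by (simp only: val)
    also have "\<dots> = (\<Sum>k\<in>(\<lambda>p. 2 * p + 1) ` {M..<2 * M}. cmod (f ((coupled_shift ^^ k) e)))"
      by (subst sum.reindex) (auto simp: inj_on_def)
    also have "\<dots> \<le> (\<Sum>k=0..4 * M - 1. cmod (f ((coupled_shift ^^ k) e)))"
      using that by (intro sum_mono2) auto
    also have "\<dots> \<le> real M * (4 * C)"
    proof -
      have "C * vnorm ell2 e * dual_norm ell2 f \<le> C * 1"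
        using df C(1) by (simp add: e)
      with C(2)[OF e(1) f, of "4 * M"] that
      have "(1 / real (4 * M)) * (\<Sum>k=0..4 * M - 1. cmod (f ((coupled_shift ^^ k) e))) \<le> C"
        by linarith
      then show ?thesis using that by (simp add: field_simps)
    qed
    finally have "real M * amp M \<le> real M * (4 * C)" .
    then show ?thesis using that by simp
  qed
  obtain M :: nat where M: "(4 * C) ^ 4 < real M" using reals_Archimedean2 by blast
  have "real M + 1 = amp M ^ 4"
    by (simp add: amp_def powr_powr flip: powr_numeral)
  also have "\<dots> \<le> (4 * C) ^ 4"
  proof (rule power_mono)
    have "real M > 0" using M by (smt (verit) zero_le_even_power even_numeral)
    then show "amp M \<le> 4 * C" by (intro bound) simp
  qed simp
  finally show False using M by simp
qed

theorem theorem1: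
  shows "\<exists>(H :: (nat \<Rightarrow> complex) cinner_space) T.
    complex_hilbert_space H \<and> separable_normed_space H \<and>
    bounded_operator H H T \<and>
    uniformly_kreiss_bounded H T \<and> \<not> strongly_cesaro_bounded H T"
  using complex_hilbert_space_ell2 separable_ell2 bounded_operator_coupled_shift
    uniformly_kreiss_bounded_coupled_shift not_strongly_cesaro_bounded_coupled_shift
  by blast

end
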